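(* For every positive integer $t$, there is a hereditary weakly sparse class $\mathcal C_t$ of finite graphs of unbounded treewidth such that for every finite graph $H$ of treewidth at most $t$, the subclass $\{G \in \mathcal C_t : G \text{ is } H\text{-free}\}$ has bounded treewidth.
   Context: A graph $G$ is $H$-free if $H$ is not isomorphic to an induced subgraph of $G$. A class of graphs is hereditary if it is closed under taking induced subgraphs. A class is weakly sparse if there is a finite integer $s$ such that no graph of the class contains $K_{s,s}$ as a (not necessarily induced) subgraph. A class has bounded (resp. unbounded) treewidth if the treewidths of its members are (resp. are not) bounded by a constant. *)

theory Defs
  imports Main
begin

record graph =
  verts :: "nat set"
  edges :: "nat set set"

definition wf_graph :: "graph \<Rightarrow> bool" where
  "wf_graph G \<longleftrightarrow> finite (verts G) \<and>
     (\<forall>e\<in>edges G. e \<subseteq> verts G \<and> card e = 2)"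

definition induced :: "graph \<Rightarrow> nat set \<Rightarrow> graph" where
  "induced G S = \<lparr>verts = verts G \<inter> S, edges = {e \<in> edges G. e \<subseteq> S}\<rparr>"

definition connected_graph :: "graph \<Rightarrow> bool" where
  "connected_graph G \<longleftrightarrow> verts G \<noteq> {} \<and>
     (\<forall>u\<in>verts G. \<forall>v\<in>verts G. (\<lambda>x y. {x, y} \<in> edges G)\<^sup>*\<^sup>* u v)"

definition is_tree :: "graph \<Rightarrow> bool" where
  "is_tree T \<longleftrightarrow> wf_graph T \<and> connected_graph T \<and> card (edges T) = card (verts T) - 1"

definition tree_decomp_width_le :: "graph \<Rightarrow> graph \<Rightarrow> (nat \<Rightarrow> nat set) \<Rightarrow> nat \<Rightarrow> bool" where
  "tree_decomp_width_le G T bag k \<longleftrightarrow> is_tree T \<and>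
     (\<forall>t\<in>verts T. bag t \<subseteq> verts G \<and> card (bag t) \<le> k + 1) \<and>
     (\<forall>v\<in>verts G. \<exists>t\<in>verts T. v \<in> bag t) \<and>
     (\<forall>e\<in>edges G. \<exists>t\<in>verts T. e \<subseteq> bag t) \<and>
     (\<forall>v\<in>verts G. connected_graph (induced T {t \<in> verts T. v \<in> bag t}))"

definition tw_le :: "graph \<Rightarrow> nat \<Rightarrow> bool" where
  "tw_le G k \<longleftrightarrow> (\<exists>T bag. tree_decomp_width_le G T bag k)"

definition bounded_tw :: "graph set \<Rightarrow> bool" where
  "bounded_tw C \<longleftrightarrow> (\<exists>k. \<forall>G\<in>C. tw_le G k)"

definition graph_iso :: "graph \<Rightarrow> graph \<Rightarrow> bool" where
  "graph_iso H G \<longleftrightarrow> (\<exists>f. bij_betw f (verts H) (verts G) \<and>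
     (\<forall>u\<in>verts H. \<forall>v\<in>verts H. {u, v} \<in> edges H \<longleftrightarrow> {f u, f v} \<in> edges G))"

definition H_free :: "graph \<Rightarrow> graph \<Rightarrow> bool" where
  "H_free H G \<longleftrightarrow> \<not> (\<exists>S \<subseteq> verts G. graph_iso H (induced G S))"

definition hereditary :: "graph set \<Rightarrow> bool" where
  "hereditary C \<longleftrightarrow> (\<forall>G\<in>C. \<forall>S. induced G S \<in> C)"

definition contains_Kss :: "nat \<Rightarrow> graph \<Rightarrow> bool" where
  "contains_Kss s G \<longleftrightarrow> (\<exists>A B. A \<subseteq> verts G \<and> B \<subseteq> verts G \<and> A \<inter> B = {} \<and>
      card A = s \<and> card B = s \<and> (\<forall>a\<in>A. \<forall>b\<in>B. {a, b} \<in> edges G))"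

definition weakly_sparse :: "graph set \<Rightarrow> bool" where
  "weakly_sparse C \<longleftrightarrow> (\<exists>s. \<forall>G\<in>C. \<not> contains_Kss s G)"

end

theory Submission
  imports Defs "HOL-Library.Countable"
begin

text \<open>
  The class consists of the finite induced subgraphs of layered wheels. The nodes of layer \<open>m\<close> form a
  path, every node has \<open>2 n + 1\<close> children in the next layer, and every node carries \<open>t + 1\<close> registers
  pointing to ancestors (or to itself): a child overwrites one register of its parent by itself and is
  joined to the contents of a chosen set of its parent's registers. The node types, i.e. the overwritten
  register and the chosen set, each occur with arbitrarily many colours.

  Every vertex has at most \<open>t + 3\<close> neighbours in its own and earlier layers, so the class is weakly sparse;
  the layers form a clique minor, so its treewidth is unbounded.

  Let \<open>X\<close> be a set of nodes. A tree decomposition of \<open>H\<close> of width \<open>t\<close> is a recipe for embedding \<open>H\<close>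
  below any given node by repeatedly walking down through nodes of a fixed type until a node of \<open>X\<close> is
  met. If the induced subgraph on \<open>X\<close> is \<open>H\<close>-free, some of these walks must fail, and failing walks
  combine to a path from any given node through all later layers with fewer than \<open>|H|\<close> further vertices
  of \<open>X\<close>. Such a path separates left from right, and the part of the graph between the paths of two
  consecutive nodes is attached to the rest only through these paths and the registers of the two nodes.
  Cutting recursively along such paths yields a tree decomposition of bounded width.
\<close>

section \<open>Tree decompositions as lists of bags\<close>

lemma edge_path_sym:
  "(\<lambda>x y. {x, y} \<in> E)\<^sup>*\<^sup>* u v \<Longrightarrow> (\<lambda>x y. {x, y} \<in> E)\<^sup>*\<^sup>* v u"
  by (induction rule: rtranclp_induct)
    (simp, metis (mono_tags, lifting) converse_rtranclp_into_rtranclp insert_commute)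

lemma connected_graph_rootI:
  assumes "r \<in> verts G" "\<And>u. u \<in> verts G \<Longrightarrow> (\<lambda>x y. {x, y} \<in> edges G)\<^sup>*\<^sup>* u r"
  shows "connected_graph G"
  unfolding connected_graph_def
proof (intro conjI ballI)
  fix u v assume "u \<in> verts G" "v \<in> verts G"
  then show "(\<lambda>x y. {x, y} \<in> edges G)\<^sup>*\<^sup>* u v"
    using rtranclp_trans[OF assms(2) edge_path_sym[OF assms(2)]] by blast
qed (use assms(1) in blast)

definition add_leaf :: "graph \<Rightarrow> nat \<Rightarrow> nat \<Rightarrow> graph" where
  "add_leaf T l p = \<lparr>verts = insert l (verts T), edges = insert {l, p} (edges T)\<rparr>"

lemma connected_add_leaf:
  assumes "connected_graph T" "p \<in> verts T"
  shows "connected_graph (add_leaf T l p)"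
proof (rule connected_graph_rootI[of p])
  fix u assume "u \<in> verts (add_leaf T l p)"
  then consider "u = l" | "u \<in> verts T" by (auto simp: add_leaf_def)
  then show "(\<lambda>x y. {x, y} \<in> edges (add_leaf T l p))\<^sup>*\<^sup>* u p"
  proof cases
    case 1 then show ?thesis by (intro r_into_rtranclp) (simp add: add_leaf_def)
  next
    case 2
    then have "(\<lambda>x y. {x, y} \<in> edges T)\<^sup>*\<^sup>* u p" using assms by (auto simp: connected_graph_def)
    then show ?thesis by (rule rtranclp_mono[THEN predicate2D, rotated]) (auto simp: add_leaf_def)
  qed
qed (use assms in \<open>simp add: add_leaf_def\<close>)

lemma finite_edges: "wf_graph G \<Longrightarrow> finite (edges G)"
  by (rule finite_subset[of _ "Pow (verts G)"]) (auto simp: wf_graph_def)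

lemma is_tree_add_leaf:
  assumes "is_tree T" "p \<in> verts T" "l \<notin> verts T"
  shows "is_tree (add_leaf T l p)"
proof -
  have wf: "wf_graph T" and c: "card (edges T) = card (verts T) - 1" and cn: "connected_graph T"
    using assms by (auto simp: is_tree_def)
  have "{l, p} \<notin> edges T" using wf assms by (auto simp: wf_graph_def)
  \<comment> \<open>The subtraction in \<open>is_tree\<close> is truncated, so positivity is
    required.\<close>
  moreover have "card (verts T) > 0" using assms wf by (auto simp: wf_graph_def card_gt_0_iff)
  moreover have "finite (edges T)" using wf by (rule finite_edges)
  ultimately show ?thesis
    using wf c assms connected_add_leaf[OF cn assms(2), of l]
    by (auto simp: is_tree_def add_leaf_def wf_graph_def card_insert_if)
qed

text \<open>
  The running intersection property: each bag meets the union of the earlier ones inside a single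
  earlier bag, to which it is attached as a leaf of the decomposition tree.
\<close>

inductive rip :: "'a set list \<Rightarrow> bool" where
  single: "rip [b]"
| snoc: "rip bs \<Longrightarrow> c \<in> set bs \<Longrightarrow> b \<inter> \<Union>(set bs) \<subseteq> c \<Longrightarrow> rip (bs @ [b])"

lemma rip_nonempty: "rip bs \<Longrightarrow> bs \<noteq> []"
  by (induction rule: rip.induct) auto

text \<open>The first bag of \<open>bs2\<close> hangs from \<open>c\<close>. Every later bag
  \<open>b\<close> keeps its parent \<open>d\<close> in \<open>bs2\<close>: what it shares with
  \<open>bs1\<close> lies in \<open>hd bs2\<close>, so in the part of \<open>b\<close> already
  covered by \<open>d\<close>.\<close>

lemma rip_append:
  assumes "rip bs2" "rip bs1" "c \<in> set bs1"
    and "\<Union>(set bs1) \<inter> \<Union>(set bs2) \<subseteq> c" "\<Union>(set bs1) \<inter> \<Union>(set bs2) \<subseteq> hd bs2"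
  shows "rip (bs1 @ bs2)"
  using assms
proof (induction rule: rip.induct)
  case (single b)
  then show ?case by (intro rip.snoc[of bs1 c]) auto
next
  case (snoc bs d b)
  have ne: "bs \<noteq> []" using snoc.hyps(1) by (rule rip_nonempty)
  then have h: "hd (bs @ [b]) = hd bs" "hd bs \<in> set bs" by auto
  have "rip (bs1 @ bs)" using snoc h by auto
  moreover have "d \<in> set (bs1 @ bs)" using snoc by auto
  moreover have "b \<inter> \<Union>(set (bs1 @ bs)) \<subseteq> d" using snoc h by fastforce
  ultimately have "rip ((bs1 @ bs) @ [b])" by (rule rip.snoc)
  then show ?case by simp
qed

lemma rip_map:
  assumes "rip bs" "inj f"
  shows "rip (map ((`) f) bs)"
  using assms
proof (induction rule: rip.induct)
  case (single b) then show ?case by (simp add: rip.single)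
next
  case (snoc bs c b)
  have "f ` b \<inter> \<Union>(set (map ((`) f) bs)) = f ` b \<inter> f ` \<Union>(set bs)" by auto
  also have "\<dots> = f ` (b \<inter> \<Union>(set bs))" using snoc.prems by (simp add: image_Int)
  also have "\<dots> \<subseteq> f ` c" using snoc by blast
  finally have "rip (map ((`) f) bs @ [f ` b])"
    using snoc by (intro rip.snoc[of _ "f ` c"]) auto
  then show ?case by simp
qed

text \<open>The nodes are the list positions, and an appended bag becomes a leaf at the position of
  \<open>c\<close>. If \<open>v\<close> lies in it and in an earlier bag, then
  \<open>v \<in> c\<close>, so the leaf is attached to the subtree of \<open>v\<close>.\<close>

lemma rip_tree:
  "rip bs \<Longrightarrow> \<exists>T. verts T = {..<length bs} \<and> is_tree T \<and>
     (\<forall>v\<in>\<Union>(set bs). connected_graph (induced T {i \<in> verts T. v \<in> bs ! i}))"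
proof (induction rule: rip.induct)
  case (single b)
  have "is_tree \<lparr>verts = {0}, edges = {}\<rparr>"
    by (auto simp: is_tree_def wf_graph_def connected_graph_def)
  moreover have "connected_graph (induced \<lparr>verts = {0}, edges = {}\<rparr> {i \<in> {0}. v \<in> [b] ! i})"
    if "v \<in> b" for v using that by (auto simp: connected_graph_def induced_def)
  ultimately show ?case
    by (intro exI[of _ "\<lparr>verts = {0}, edges = {}\<rparr>"]) auto
next
  case (snoc bs c b)
  then obtain T where T: "verts T = {..<length bs}" "is_tree T"
    "\<And>v. v \<in> \<Union>(set bs) \<Longrightarrow> connected_graph (induced T {i \<in> verts T. v \<in> bs ! i})"
    by blast
  obtain p where p: "p < length bs" "bs ! p = c" using snoc.hyps by (auto simp: in_set_conv_nth)
  let ?l = "length bs"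
  let ?T = "add_leaf T ?l p"
  have tr: "is_tree ?T" using T p by (intro is_tree_add_leaf) auto
  have vT: "verts ?T = {..<length (bs @ [b])}" using T by (auto simp: add_leaf_def)
  have wf: "wf_graph T" using T by (simp add: is_tree_def)
  have "connected_graph (induced ?T {i \<in> verts ?T. v \<in> (bs @ [b]) ! i})"
    if v: "v \<in> \<Union>(set (bs @ [b]))" for v
  proof -
    let ?S = "{i \<in> verts T. v \<in> bs ! i}"
    have S: "{i \<in> verts ?T. v \<in> (bs @ [b]) ! i} = (if v \<in> b then insert ?l ?S else ?S)"
    proof (rule set_eqI)
      fix i
      consider "i < ?l" | "i = ?l" | "i > ?l" by linarith
      then show "i \<in> {i \<in> verts ?T. v \<in> (bs @ [b]) ! i} \<longleftrightarrow> i \<in> (if v \<in> b then insert ?l ?S else ?S)"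
        unfolding vT T(1) by cases (simp_all add: nth_append)
    qed
    have eT: "e \<subseteq> verts T" if "e \<in> edges T" for e using wf that by (auto simp: wf_graph_def)
    have lT: "?l \<notin> verts T" using T(1) by simp
    show ?thesis
    proof (cases "v \<in> b")
      case False
      then have "induced ?T ?S = induced T ?S" using lT by (auto simp: induced_def add_leaf_def)
      moreover have "v \<in> \<Union>(set bs)" using v False by auto
      ultimately show ?thesis using T(3)[of v] S False by simp
    next
      case vb: True
      show ?thesis
      proof (cases "v \<in> \<Union>(set bs)")
        case False
        then have "?S = {}" using T(1) by auto
        then have "{i \<in> verts ?T. v \<in> (bs @ [b]) ! i} = {?l}" unfolding S using vb by (simp only: if_True)
        then have "verts (induced ?T {i \<in> verts ?T. v \<in> (bs @ [b]) ! i}) = {?l}"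
          unfolding vT by (simp add: induced_def vT)
        then show ?thesis by (intro connected_graph_rootI[of ?l]) auto
      next
        case True
        then have "v \<in> c" using snoc vb by blast
        then have pS: "p \<in> ?S" using p T(1) by auto
        have "induced ?T (insert ?l ?S) = add_leaf (induced T ?S) ?l p"
          using pS lT eT p T(1) by (auto simp: induced_def add_leaf_def)
        moreover have "connected_graph (add_leaf (induced T ?S) ?l p)"
          using T(3)[OF True] pS p T(1) by (intro connected_add_leaf) (auto simp: induced_def)
        ultimately show ?thesis using S vb by simp
      qed
    qed
  qed
  then show ?case using tr vT by blast
qed

lemma rip_imp_tw_le:
  assumes "rip bs" "\<Union>(set bs) = verts G" "\<And>b. b \<in> set bs \<Longrightarrow> card b \<le> k + 1"
    and "\<And>e. e \<in> edges G \<Longrightarrow> \<exists>b\<in>set bs. e \<subseteq> b"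
  shows "tw_le G k"
proof -
  obtain T where T: "verts T = {..<length bs}" "is_tree T"
    "\<And>v. v \<in> \<Union>(set bs) \<Longrightarrow> connected_graph (induced T {i \<in> verts T. v \<in> bs ! i})"
    using rip_tree[OF assms(1)] by blast
  have "tree_decomp_width_le G T (\<lambda>i. bs ! i) k"
    unfolding tree_decomp_width_le_def
  proof (intro conjI ballI)
    fix i assume "i \<in> verts T" then have "bs ! i \<in> set bs" using T by simp
    then show "bs ! i \<subseteq> verts G" "card (bs ! i) \<le> k + 1" using assms by auto
  next
    fix v assume "v \<in> verts G"
    then show "\<exists>i\<in>verts T. v \<in> bs ! i"
      using assms(2) T(1) by (metis UnionE in_set_conv_nth lessThan_iff)
    show "connected_graph (induced T {i \<in> verts T. v \<in> bs ! i})"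
      using \<open>v \<in> verts G\<close> T(3) assms(2) by simp
  next
    fix e assume "e \<in> edges G"
    then show "\<exists>i\<in>verts T. e \<subseteq> bs ! i"
      using assms(4) T(1) by (metis in_set_conv_nth lessThan_iff)
  qed (use T in auto)
  then show ?thesis by (auto simp: tw_le_def)
qed

section \<open>Recovering a list of bags from a tree decomposition\<close>

lemma connected_graph_neighbour:
  assumes "connected_graph G" "u \<in> verts G" "v \<in> verts G" "u \<noteq> v"
  obtains w where "{u, w} \<in> edges G"
proof -
  have "(\<lambda>x y. {x, y} \<in> edges G)\<^sup>*\<^sup>* u v" using assms by (auto simp: connected_graph_def)
  then show ?thesis using \<open>u \<noteq> v\<close> that by (cases rule: converse_rtranclpE) auto
qed

text \<open>By double counting, the degrees sum to \<open>2 * (card (verts T) - 1)\<close>, so some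
  vertex has degree below 2; connectedness gives it a neighbour.\<close>

lemma tree_leaf:
  assumes "is_tree T" "card (verts T) \<noteq> 1"
  obtains l p where "l \<in> verts T" "p \<in> verts T" "l \<noteq> p" "{e \<in> edges T. l \<in> e} = {{l, p}}"
proof -
  have wf: "wf_graph T" and cn: "connected_graph T" and c: "card (edges T) = card (verts T) - 1"
    using assms by (auto simp: is_tree_def)
  have fV: "finite (verts T)" and fE: "finite (edges T)" using wf finite_edges by (auto simp: wf_graph_def)
  have pos: "card (verts T) > 0" using cn fV by (auto simp: connected_graph_def card_gt_0_iff)
  have "(\<Sum>v\<in>verts T. card {e \<in> edges T. v \<in> e}) = (\<Sum>v\<in>verts T. \<Sum>e\<in>edges T. if v \<in> e then 1 else 0)"
    using fE by (intro sum.cong) (auto simp: sum.If_cases Int_def)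
  also have "\<dots> = (\<Sum>e\<in>edges T. \<Sum>v\<in>verts T. if v \<in> e then 1 else 0)" by (rule sum.swap)
  also have "\<dots> = (\<Sum>e\<in>edges T. 2)"
  proof (rule sum.cong)
    fix e assume "e \<in> edges T"
    then have "verts T \<inter> {v. v \<in> e} = e" "card e = 2" using wf by (auto simp: wf_graph_def)
    then show "(\<Sum>v\<in>verts T. if v \<in> e then 1 else 0) = (2::nat)" using fV by (simp add: sum.If_cases)
  qed simp
  finally have deg: "(\<Sum>v\<in>verts T. card {e \<in> edges T. v \<in> e}) = 2 * (card (verts T) - 1)" using c by simp
  have "\<exists>l\<in>verts T. card {e \<in> edges T. l \<in> e} < 2"
  proof (rule ccontr)
    assume "\<not> ?thesis"
    then have "(\<Sum>v\<in>verts T. 2) \<le> (\<Sum>v\<in>verts T. card {e \<in> edges T. v \<in> e})"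
      by (intro sum_mono) auto
    then show False using deg pos by simp
  qed
  then obtain l where l: "l \<in> verts T" "card {e \<in> edges T. l \<in> e} < 2" by blast
  have "verts T \<noteq> {l}" using assms(2) by auto
  then obtain u where u: "u \<in> verts T" "u \<noteq> l" using l by blast
  obtain p where p: "{l, p} \<in> edges T" using connected_graph_neighbour[OF cn l(1) u(1)] u by metis
  have lp: "l \<noteq> p" "p \<in> verts T" using wf p by (auto simp: wf_graph_def)
  have "{{l, p}} \<subseteq> {e \<in> edges T. l \<in> e}" using p by auto
  moreover have "card {e \<in> edges T. l \<in> e} \<le> card {{l, p}}" using l by simp
  moreover have "finite {e \<in> edges T. l \<in> e}" using fE by simp
  ultimately have "{{l, p}} = {e \<in> edges T. l \<in> e}" by (intro card_seteq) auto
  then show ?thesis using that[OF l(1) lp(2) lp(1)] by simp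
qed

text \<open>A walk can enter and leave \<open>l\<close> only through \<open>p\<close>, so its visits
  to \<open>l\<close> can be cut out.\<close>

lemma connected_remove_leaf:
  assumes "connected_graph G" "verts G - {l} \<noteq> {}"
    and nb: "\<And>x. {l, x} \<in> edges G \<Longrightarrow> x = p"
    and wf: "\<And>e. e \<in> edges G \<Longrightarrow> e \<subseteq> verts G"
  shows "connected_graph (induced G (verts G - {l}))"
proof -
  let ?G = "induced G (verts G - {l})"
  \<comment> \<open>While the walk sits at \<open>l\<close>, the shortened walk waits at
    \<open>p\<close>.\<close>
  have *: "(x \<noteq> l \<longrightarrow> (\<lambda>x y. {x, y} \<in> edges ?G)\<^sup>*\<^sup>* u x) \<and>
           (x = l \<longrightarrow> (\<lambda>x y. {x, y} \<in> edges ?G)\<^sup>*\<^sup>* u p)"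
    if "(\<lambda>x y. {x, y} \<in> edges G)\<^sup>*\<^sup>* u x" "u \<noteq> l" for u x
    using that
  proof (induction rule: rtranclp_induct)
    case base then show ?case by simp
  next
    case (step y z)
    consider "y = l" | "y \<noteq> l" "z = l" | "y \<noteq> l" "z \<noteq> l" by blast
    then show ?case
    proof cases
      case 1
      then show ?thesis using step nb by auto
    next
      case 2
      then show ?thesis using step nb[of y] by (auto simp: insert_commute)
    next
      case 3
      then have "{y, z} \<in> edges ?G" using step wf by (force simp: induced_def)
      then show ?thesis using step 3 by (auto intro: rtranclp.rtrancl_into_rtrancl)
    qed
  qed
  show ?thesis using assms(1,2) * unfolding connected_graph_def by (auto simp: induced_def)
qed

text \<open>Leaves are removed one by one; the bag of \<open>l\<close> comes last in the list and
  hangs from the bag of its neighbour \<open>p\<close>.\<close>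

lemma tree_decomp_rip:
  assumes "is_tree T"
    and "\<And>v. v \<in> \<Union>(bag ` verts T) \<Longrightarrow> connected_graph (induced T {i \<in> verts T. v \<in> bag i})"
  shows "\<exists>bs. rip bs \<and> set bs = bag ` verts T"
  using assms
proof (induction "card (verts T)" arbitrary: T rule: less_induct)
  case less
  have wf: "wf_graph T" and cn: "connected_graph T" and c: "card (edges T) = card (verts T) - 1"
    using less.prems by (auto simp: is_tree_def)
  have fV: "finite (verts T)" and fE: "finite (edges T)" using wf finite_edges by (auto simp: wf_graph_def)
  have eT: "e \<subseteq> verts T" if "e \<in> edges T" for e using wf that by (auto simp: wf_graph_def)
  show ?case
  proof (cases "card (verts T) = 1")
    case True
    then obtain x where "verts T = {x}" by (auto simp: card_1_singleton_iff)
    then show ?thesis by (intro exI[of _ "[bag x]"]) (auto intro: rip.single)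
  next
    case False
    then obtain l p where lp: "l \<in> verts T" "p \<in> verts T" "l \<noteq> p" "{e \<in> edges T. l \<in> e} = {{l, p}}"
      using tree_leaf less.prems by metis
    have nb: "x = p" if "{l, x} \<in> edges T" for x
    proof -
      have "{l, x} \<in> {e \<in> edges T. l \<in> e}" using that by auto
      then have "{l, x} = {l, p}" using lp(4) by simp
      then show ?thesis using lp(3) by (auto simp: doubleton_eq_iff)
    qed
    let ?T = "induced T (verts T - {l})"
    have vT: "verts ?T = verts T - {l}" by (auto simp: induced_def)
    have cn': "connected_graph ?T"
    proof (rule connected_remove_leaf[OF cn])
      show "verts T - {l} \<noteq> {}" using lp by blast
      show "x = p" if "{l, x} \<in> edges T" for x using nb that .
    qed (rule eT)
    have "edges ?T = edges T - {e \<in> edges T. l \<in> e}" using eT by (auto simp: induced_def)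
    then have E: "edges ?T = edges T - {{l, p}}" using lp(4) by simp
    have "{l, p} \<in> edges T" using lp(4) by auto
    then have "card (edges ?T) = card (edges T) - 1" using E fE by (simp add: card_Diff_singleton)
    then have tr: "is_tree ?T" using cn' c wf lp fV unfolding is_tree_def vT
      by (auto simp: wf_graph_def induced_def)
    have less': "card (verts ?T) < card (verts T)" unfolding vT using lp fV
      by (meson card_Diff1_less)
    have con: "connected_graph (induced ?T {i \<in> verts ?T. v \<in> bag i})"
      if v: "v \<in> \<Union>(bag ` verts ?T)" for v
    proof -
      let ?S = "{i \<in> verts T. v \<in> bag i}"
      let ?Q = "induced T ?S"
      have Q: "connected_graph ?Q" using v less.prems(2) vT by auto
      have vQ: "verts ?Q = ?S" by (auto simp: induced_def)
      have "connected_graph (induced ?Q (verts ?Q - {l}))"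
      proof (rule connected_remove_leaf[OF Q])
        show "verts ?Q - {l} \<noteq> {}" using v vT unfolding vQ by auto
        show "x = p" if "{l, x} \<in> edges ?Q" for x using that nb by (auto simp: induced_def)
        show "e \<subseteq> verts ?Q" if "e \<in> edges ?Q" for e using that by (auto simp: induced_def)
      qed
      moreover have "induced ?Q (verts ?Q - {l}) = induced ?T {i \<in> verts ?T. v \<in> bag i}"
        unfolding vQ vT by (auto simp: induced_def)
      ultimately show ?thesis by simp
    qed
    obtain bs where bs: "rip bs" "set bs = bag ` verts ?T" using less.hyps[OF less' tr con] by blast
    \<comment> \<open>The subtree of a shared vertex contains \<open>l\<close> and another node, so
      it uses the only edge at \<open>l\<close> and contains \<open>p\<close>.\<close>
    have "bag l \<inter> \<Union>(set bs) \<subseteq> bag p"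
    proof
      fix v assume "v \<in> bag l \<inter> \<Union>(set bs)"
      then obtain i where i: "v \<in> bag l" "v \<in> bag i" "i \<in> verts T" "i \<noteq> l" using bs vT by auto
      let ?Q = "induced T {i \<in> verts T. v \<in> bag i}"
      have "connected_graph ?Q" using less.prems(2) i by blast
      moreover have "l \<in> verts ?Q" "i \<in> verts ?Q" using i lp by (auto simp: induced_def)
      ultimately obtain w where "{l, w} \<in> edges ?Q" using connected_graph_neighbour i by metis
      then have "w = p" "v \<in> bag w" using nb by (auto simp: induced_def)
      then show "v \<in> bag p" by simp
    qed
    moreover have "bag p \<in> set bs" using bs vT lp by auto
    ultimately have "rip (bs @ [bag l])" using bs rip.snoc by metis
    moreover have "set (bs @ [bag l]) = bag ` verts T" using bs vT lp by auto
    ultimately show ?thesis by blast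
  qed
qed

lemma tw_le_imp_rip:
  assumes "tw_le G k" "wf_graph G"
  obtains bs where "rip bs" "\<Union>(set bs) = verts G" "\<And>b. b \<in> set bs \<Longrightarrow> card b \<le> k + 1"
    "\<And>e. e \<in> edges G \<Longrightarrow> \<exists>b\<in>set bs. e \<subseteq> b"
proof -
  obtain T bag where td: "tree_decomp_width_le G T bag k" using assms by (auto simp: tw_le_def)
  then have U: "\<Union>(bag ` verts T) = verts G" unfolding tree_decomp_width_le_def by blast
  have "is_tree T" "\<And>v. v \<in> \<Union>(bag ` verts T) \<Longrightarrow> connected_graph (induced T {i \<in> verts T. v \<in> bag i})"
    using td unfolding tree_decomp_width_le_def U by simp_all
  then obtain bs where bs: "rip bs" "set bs = bag ` verts T"
    using tree_decomp_rip[of T bag] by blast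
  show ?thesis
  proof (rule that[of bs])
    show "card b \<le> k + 1" if "b \<in> set bs" for b
      using that td unfolding tree_decomp_width_le_def bs by blast
    show "\<exists>b\<in>set bs. e \<subseteq> b" if "e \<in> edges G" for e
      using that td unfolding tree_decomp_width_le_def bs by simp
  qed (use bs U in auto)
qed


text \<open>
  Connectedness of \<open>B i\<close> is expressed by cuts, with two vertices regarded as adjacent if they share a
  bag; in this form it survives the removal of the last bag.
\<close>

lemma rip_helly:
  assumes "rip bs" "finite I" "I \<noteq> {}"
    and "\<And>i. i \<in> I \<Longrightarrow> B i \<noteq> {}" "\<And>i. i \<in> I \<Longrightarrow> B i \<subseteq> \<Union>(set bs)"
    and "\<And>i S. i \<in> I \<Longrightarrow> S \<subseteq> B i \<Longrightarrow> S \<noteq> {} \<Longrightarrow> S \<noteq> B i \<Longrightarrow>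
           \<exists>b\<in>set bs. b \<inter> S \<noteq> {} \<and> b \<inter> (B i - S) \<noteq> {}"
    and "\<And>i j. i \<in> I \<Longrightarrow> j \<in> I \<Longrightarrow> \<exists>b\<in>set bs. b \<inter> B i \<noteq> {} \<and> b \<inter> B j \<noteq> {}"
  shows "\<exists>b\<in>set bs. \<forall>i\<in>I. b \<inter> B i \<noteq> {}"
  using assms
proof (induction arbitrary: B rule: rip.induct)
  case (single b)
  then show ?case by force
next
  case (snoc bs c b)
  let ?V = "\<Union>(set bs)"
  show ?case
  proof (cases "\<exists>i\<in>I. B i \<inter> ?V = {}")
    case True
    \<comment> \<open>A set without earlier vertices can touch the others only in the new bag, which
      therefore meets all of them.\<close>
    then obtain i where i: "i \<in> I" "B i \<inter> ?V = {}" by blast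
    have "b \<inter> B j \<noteq> {}" if j: "j \<in> I" for j
    proof -
      obtain b' where "b' \<in> set (bs @ [b])" "b' \<inter> B i \<noteq> {}" "b' \<inter> B j \<noteq> {}"
        using snoc.prems(6)[OF i(1) j] by blast
      then show ?thesis using i by auto
    qed
    then show ?thesis by auto
  next
    case False
    have new: "x \<in> b" if "i \<in> I" "x \<in> B i" "x \<notin> ?V" for i x
      using snoc.prems(4)[OF that(1)] that by auto
    \<comment> \<open>After restriction to earlier vertices \<open>c\<close> replaces
      \<open>b\<close>. If \<open>b\<close> met only new vertices of \<open>B i\<close>, no bag
      would cross the cut between its new and old vertices.\<close>
    have hit: "c \<inter> (B i \<inter> ?V) \<noteq> {}" if i: "i \<in> I" "b \<inter> B i \<noteq> {}" for i
    proof (cases "b \<inter> B i \<inter> ?V = {}")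
      case False
      then show ?thesis using snoc.hyps by blast
    next
      case True
      have "B i - ?V \<noteq> {}" using True i by auto
      moreover have "B i - ?V \<noteq> B i" using False i by auto
      ultimately obtain b' where b': "b' \<in> set (bs @ [b])" "b' \<inter> (B i - ?V) \<noteq> {}"
        "b' \<inter> (B i - (B i - ?V)) \<noteq> {}"
        using snoc.prems(5)[OF i(1), of "B i - ?V"] by blast
      then have "b' = b" by auto
      then show ?thesis using b' True by auto
    qed
    have "\<exists>b\<in>set bs. \<forall>i\<in>I. b \<inter> (B i \<inter> ?V) \<noteq> {}"
    proof (rule snoc.IH[OF snoc.prems(1,2)])
      fix i S assume i: "i \<in> I" and S: "S \<subseteq> B i \<inter> ?V" "S \<noteq> {}" "S \<noteq> B i \<inter> ?V"
      show "\<exists>b\<in>set bs. b \<inter> S \<noteq> {} \<and> b \<inter> (B i \<inter> ?V - S) \<noteq> {}"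
      proof (cases "b \<inter> S = {}")
        case True
        have "S \<noteq> B i" "S \<subseteq> B i" using S by auto
        then obtain b' where b': "b' \<in> set (bs @ [b])" "b' \<inter> S \<noteq> {}" "b' \<inter> (B i - S) \<noteq> {}"
          using snoc.prems(5)[OF i] S by blast
        then have "b' \<in> set bs" using True by auto
        then show ?thesis using b' by (intro bexI[of _ b']) auto
      next
        case bS: False
        show ?thesis
        proof (cases "b \<inter> (B i \<inter> ?V - S) = {}")
          case False
          then have "c \<inter> S \<noteq> {}" "c \<inter> (B i \<inter> ?V - S) \<noteq> {}" using snoc.hyps bS S by blast+
          then show ?thesis using snoc.hyps by blast
        next
          case True
          \<comment> \<open>Here \<open>b\<close> meets the old vertices of \<open>B i\<close> only
            in \<open>S\<close>. Adding the new vertices to this side keeps \<open>b\<close> from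
            crossing the cut, so an earlier bag crosses it.\<close>
          let ?S = "S \<union> (B i - ?V)"
          have "?S \<noteq> B i" "?S \<subseteq> B i" "?S \<noteq> {}" using S by auto
          then obtain b' where b': "b' \<in> set (bs @ [b])" "b' \<inter> ?S \<noteq> {}" "b' \<inter> (B i - ?S) \<noteq> {}"
            using snoc.prems(5)[OF i, of ?S] by metis
          have "B i - ?S = B i \<inter> ?V - S" by auto
          then have "b' \<in> set bs" using b' True by auto
          then have "b' \<inter> S \<noteq> {}" "b' \<inter> (B i \<inter> ?V - S) \<noteq> {}" using b' by auto
          then show ?thesis using \<open>b' \<in> set bs\<close> by blast
        qed
      qed
    next
      fix i j assume ij: "i \<in> I" "j \<in> I"
      obtain b' where b': "b' \<in> set (bs @ [b])" "b' \<inter> B i \<noteq> {}" "b' \<inter> B j \<noteq> {}"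
        using snoc.prems(6)[OF ij] by blast
      show "\<exists>b\<in>set bs. b \<inter> (B i \<inter> ?V) \<noteq> {} \<and> b \<inter> (B j \<inter> ?V) \<noteq> {}"
      proof (cases "b' \<in> set bs")
        case True then show ?thesis using b' by (intro bexI[of _ b']) auto
      next
        case False
        then have "b' = b" using b' by auto
        then have "b \<inter> B i \<noteq> {}" "b \<inter> B j \<noteq> {}" using b' by auto
        then show ?thesis using hit[OF ij(1)] hit[OF ij(2)] snoc.hyps(2) by (intro bexI[of _ c]) auto
      qed
    qed (use False in auto)
    then show ?thesis by force
  qed
qed

section \<open>Decompositions with a root bag\<close>

text \<open>\<open>R\<close> is the bag at which a decomposition of \<open>W\<close> can be glued to
  others; it heads the list, as in \<open>rip_append\<close>. Here \<open>k\<close> bounds the size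
  of the bags, not the width.\<close>

definition rooted_decomp :: "('a \<Rightarrow> 'a \<Rightarrow> bool) \<Rightarrow> nat \<Rightarrow> 'a set \<Rightarrow> 'a set \<Rightarrow> bool" where
  "rooted_decomp A k W R \<longleftrightarrow> (\<exists>bs. rip bs \<and> hd bs = R \<and> \<Union>(set bs) = W \<and>
     (\<forall>b\<in>set bs. card b \<le> k) \<and> (\<forall>x\<in>W. \<forall>y\<in>W. A x y \<longrightarrow> (\<exists>b\<in>set bs. x \<in> b \<and> y \<in> b)))"

lemma rooted_decomp_bag: "card R \<le> k \<Longrightarrow> rooted_decomp A k R R"
  unfolding rooted_decomp_def by (intro exI[of _ "[R]"]) (auto intro: rip.single)

text \<open>The common part lies in both root bags, so the lists can be appended; by
  \<open>sep\<close> an adjacent pair lies within one side and is covered there.\<close>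

lemma rooted_decomp_glue:
  assumes "rooted_decomp A k W1 R1" "rooted_decomp A k W2 R2"
    and sub: "W1 \<inter> W2 \<subseteq> R1" "W1 \<inter> W2 \<subseteq> R2"
    and sep: "\<And>x y. x \<in> W1 - W2 \<Longrightarrow> y \<in> W2 - W1 \<Longrightarrow> \<not> A x y \<and> \<not> A y x"
  shows "rooted_decomp A k (W1 \<union> W2) R1"
proof -
  obtain bs1 where b1: "rip bs1" "hd bs1 = R1" "\<Union>(set bs1) = W1" "\<forall>b\<in>set bs1. card b \<le> k"
    "\<forall>x\<in>W1. \<forall>y\<in>W1. A x y \<longrightarrow> (\<exists>b\<in>set bs1. x \<in> b \<and> y \<in> b)"
    using assms(1) unfolding rooted_decomp_def by blast
  obtain bs2 where b2: "rip bs2" "hd bs2 = R2" "\<Union>(set bs2) = W2" "\<forall>b\<in>set bs2. card b \<le> k"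
    "\<forall>x\<in>W2. \<forall>y\<in>W2. A x y \<longrightarrow> (\<exists>b\<in>set bs2. x \<in> b \<and> y \<in> b)"
    using assms(2) unfolding rooted_decomp_def by blast
  have ne: "bs1 \<noteq> []" using b1 by (simp add: rip_nonempty)
  have "R1 \<in> set bs1" using b1(2) ne by auto
  then have "rip (bs1 @ bs2)"
    using rip_append[OF b2(1) b1(1)] sub unfolding b1(3) b2(2,3) by blast
  moreover have "\<exists>b\<in>set (bs1 @ bs2). x \<in> b \<and> y \<in> b"
    if xy: "x \<in> W1 \<union> W2" "y \<in> W1 \<union> W2" "A x y" for x y
  proof -
    consider "x \<in> W1" "y \<in> W1" | "x \<in> W2" "y \<in> W2" using xy sep by blast
    then show ?thesis
    proof cases
      case 1 then show ?thesis using b1(5) xy(3) by (metis Un_iff set_append)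
    next
      case 2 then show ?thesis using b2(5) xy(3) by (metis Un_iff set_append)
    qed
  qed
  moreover have "hd (bs1 @ bs2) = R1" "\<Union>(set (bs1 @ bs2)) = W1 \<union> W2"
    "\<forall>b\<in>set (bs1 @ bs2). card b \<le> k"
    using ne b1 b2 by auto
  ultimately show ?thesis unfolding rooted_decomp_def by blast
qed

text \<open>The single bag \<open>R'\<close> is put in front as a new root, from which the old root
  hangs.\<close>

lemma rooted_decomp_reroot:
  assumes "rooted_decomp A k W R" "card R' \<le> k" "W \<inter> R' \<subseteq> R"
    and "\<And>x y. x \<in> W - R' \<Longrightarrow> y \<in> R' - W \<Longrightarrow> \<not> A x y \<and> \<not> A y x"
  shows "rooted_decomp A k (W \<union> R') R'"
proof -
  have "rooted_decomp A k (R' \<union> W) R'"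
    by (rule rooted_decomp_glue[OF rooted_decomp_bag[OF assms(2)] assms(1)]) (use assms(3,4) in blast)+
  then show ?thesis by (simp add: Un_commute)
qed

lemma card_Un5:
  "card (A \<union> ((B \<union> C) \<union> (D \<union> E))) \<le> card A + ((card B + card C) + (card D + card E))"
  by (intro order_trans[OF card_Un_le] add_mono card_Un_le order_refl)

section \<open>Layered wheels with registers\<close>

text \<open>A node of type \<open>j\<close> overwrites register \<open>slot j\<close> and is joined
  to the contents of the registers in \<open>sel j\<close>. The infinitely many types with equal
  data are the colours.\<close>

locale register_wheel =
  fixes t :: nat and slot :: "nat \<Rightarrow> nat" and sel :: "nat \<Rightarrow> nat set"
  assumes slot_le: "slot j \<le> t" and sel_le: "sel j \<subseteq> {..t}"
    and rich: "s \<le> t \<Longrightarrow> \<alpha> \<subseteq> {..t} \<Longrightarrow> infinite {j. slot j = s \<and> sel j = \<alpha>}"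
begin

text \<open>
  The node \<open>v\<close> of layer \<open>m\<close> is the pair \<open>(m, v)\<close>; its parent is \<open>(m - 1, v div N)\<close> and its index
  among its siblings is \<open>v mod N\<close>. Layer 0 is infinite, so there is no outermost node.
  The type of a node depends on half of its index: embeddings only use odd indices, and
  for odd \<open>N\<close> two nodes of odd index are never consecutive in a layer.
\<close>

definition tp :: "int \<Rightarrow> int \<Rightarrow> nat" where
  "tp N v = nat (v mod N) div 2"

primrec reg :: "int \<Rightarrow> nat \<Rightarrow> int \<Rightarrow> nat \<Rightarrow> nat \<times> int" where
  "reg N 0 v s = (0, v)"
| "reg N (Suc m) v s = (if s = slot (tp N v) then (Suc m, v) else reg N m (v div N) s)"

fun ups :: "int \<Rightarrow> nat \<times> int \<Rightarrow> (nat \<times> int) set" where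
  "ups N (0, v) = {}"
| "ups N (Suc m, v) = reg N m (v div N) ` sel (tp N v)"

definition adj :: "int \<Rightarrow> nat \<times> int \<Rightarrow> nat \<times> int \<Rightarrow> bool" where
  "adj N x y \<longleftrightarrow> y \<in> ups N x \<or> x \<in> ups N y \<or> (fst x = fst y \<and> \<bar>snd x - snd y\<bar> = 1)"

definition regs :: "int \<Rightarrow> nat \<Rightarrow> int \<Rightarrow> (nat \<times> int) set" where
  "regs N m v = reg N m v ` {..t}"

lemma adj_sym: "adj N x y \<longleftrightarrow> adj N y x"
  unfolding adj_def by (auto simp: abs_minus_commute)

lemma reg_layer: "fst (reg N m v s) \<le> m"
  by (induction m arbitrary: v) (auto simp: le_SucI)

lemma self_in_regs: "(m, v) \<in> regs N m v"
proof (cases m)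
  case (Suc m')
  then have "(m, v) = reg N m v (slot (tp N v))" by simp
  then show ?thesis unfolding regs_def using slot_le by blast
qed (auto simp: regs_def)

lemma finite_regs: "finite (regs N m v)" and card_regs: "card (regs N m v) \<le> t + 1"
  unfolding regs_def by (simp, metis Suc_eq_plus1 card_atMost card_image_le finite_atMost)

lemma regs_layer: "x \<in> regs N m v \<Longrightarrow> fst x \<le> m"
  by (auto simp: regs_def reg_layer)

lemma regs_Suc: "regs N (Suc m) v \<subseteq> insert (Suc m, v) (regs N m (v div N))"
  by (auto simp: regs_def)

lemma regs_0: "regs N 0 v = {(0, v)}"
  by (auto simp: regs_def)

lemma ups_subset_regs: "ups N (Suc m, v) \<subseteq> regs N m (v div N)"
  using sel_le by (auto simp: regs_def)

lemma ups_layer: "y \<in> ups N x \<Longrightarrow> fst y < fst x"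
  by (cases "(N, x)" rule: ups.cases) (auto simp: le_imp_less_Suc reg_layer)

lemma adj_irrefl: "\<not> adj N x x"
  unfolding adj_def using ups_layer by fastforce

section \<open>Decomposition along sparse paths\<close>

text \<open>Paths are encoded as functions from layers to positions; only the values from layer
  \<open>m\<close> on are constrained.\<close>

definition descending :: "int \<Rightarrow> nat \<Rightarrow> (nat \<Rightarrow> int) \<Rightarrow> bool" where
  "descending N m P \<longleftrightarrow> (\<forall>i\<ge>m. P (Suc i) div N = P i)"

definition trail :: "nat \<Rightarrow> (nat \<Rightarrow> int) \<Rightarrow> (nat \<times> int) set" where
  "trail m P = {(i, P i) | i. m \<le> i}"

definition strip :: "nat \<Rightarrow> (nat \<Rightarrow> int) \<Rightarrow> (nat \<Rightarrow> int) \<Rightarrow> (nat \<times> int) set" where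
  "strip m P Q = {(i, v). m \<le> i \<and> P i \<le> v \<and> v \<le> Q i}"

section \<open>Paths separate left from right\<close>

lemma div_less_imp_less: "(0::int) < N \<Longrightarrow> a div N < b div N \<Longrightarrow> a < b"
  by (metis linorder_not_less zdiv_mono1)

lemma descending_less:
  assumes "0 < N" "descending N m P" "descending N m Q" "P m < Q m" "m \<le> i"
  shows "P i < Q i"
  using assms(5)
proof (induction rule: dec_induct)
  case (step i)
  then have "P (Suc i) div N < Q (Suc i) div N" using assms(2,3) by (simp add: descending_def)
  then show ?case using assms(1) div_less_imp_less by blast
qed (use assms in auto)

text \<open>A register holds an ancestor or the node itself, and monotonicity of \<open>div\<close>
  keeps all descendants of a node on its side of the path.\<close>

lemma reg_right:
  assumes N: "0 < N" and P: "descending N m P"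
    and "(i, u) = reg N j w s" "P i < u" "m \<le> i"
  shows "P j < w"
  using assms(3)
proof (induction j arbitrary: w)
  case 0 then show ?case using assms by simp
next
  case (Suc j)
  show ?case
  proof (cases "s = slot (tp N w)")
    case True then show ?thesis using Suc assms by simp
  next
    case False
    then have *: "(i, u) = reg N j (w div N) s" using Suc by simp
    then have "i \<le> j" by (metis fst_conv reg_layer)
    then have "P (Suc j) div N = P j" using P assms(5) by (simp add: descending_def)
    then show ?thesis using Suc.IH[OF *] N div_less_imp_less by metis
  qed
qed

lemma reg_left:
  assumes N: "0 < N" and P: "descending N m P"
    and "(i, u) = reg N j w s" "u < P i" "m \<le> i"
  shows "w < P j"
  using assms(3)
proof (induction j arbitrary: w)
  case 0 then show ?case using assms by simp
next
  case (Suc j)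
  show ?case
  proof (cases "s = slot (tp N w)")
    case True then show ?thesis using Suc assms by simp
  next
    case False
    then have *: "(i, u) = reg N j (w div N) s" using Suc by simp
    then have "i \<le> j" by (metis fst_conv reg_layer)
    then have "P (Suc j) div N = P j" using P assms(5) by (simp add: descending_def)
    then show ?thesis using Suc.IH[OF *] N div_less_imp_less by metis
  qed
qed

lemma ups_right:
  assumes N: "0 < N" and P: "descending N m P"
    and "(i, u) \<in> ups N (j, w)" "P i < u" "m \<le> i"
  shows "P j < w"
proof -
  obtain j' s where j: "j = Suc j'" "(i, u) = reg N j' (w div N) s" using assms(3) by (cases j) auto
  have "i \<le> j'" using j(2) by (metis fst_conv reg_layer)
  then have "P j div N = P j'" using P assms(5) j by (simp add: descending_def)
  then show ?thesis using reg_right[OF N P j(2)] assms N div_less_imp_less by metis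
qed

lemma ups_left:
  assumes N: "0 < N" and P: "descending N m P"
    and "(i, u) \<in> ups N (j, w)" "u < P i" "m \<le> i"
  shows "w < P j"
proof -
  obtain j' s where j: "j = Suc j'" "(i, u) = reg N j' (w div N) s" using assms(3) by (cases j) auto
  have "i \<le> j'" using j(2) by (metis fst_conv reg_layer)
  then have "P j div N = P j'" using P assms(5) j by (simp add: descending_def)
  then show ?thesis using reg_left[OF N P j(2)] assms N div_less_imp_less by metis
qed

text \<open>A neighbour in an earlier layer is an ancestor, which lies on the same side. Neighbours
  within a layer are consecutive, so the path cannot pass strictly between them.\<close>

lemma trail_separates:
  assumes "0 < N" "descending N m P" "m \<le> i" "P i < u" "m \<le> j" "w < P j"
  shows "\<not> adj N (i, u) (j, w)"
proof
  assume "adj N (i, u) (j, w)"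
  then consider "(j, w) \<in> ups N (i, u)" | "(i, u) \<in> ups N (j, w)" | "i = j" "\<bar>u - w\<bar> = 1"
    by (auto simp: adj_def)
  then show False
  proof cases
    case 1 then show ?thesis using ups_left[OF assms(1,2)] assms by fastforce
  next
    case 2 then show ?thesis using ups_right[OF assms(1,2)] assms by fastforce
  next
    case 3 then show ?thesis using assms(4,6) by simp
  qed
qed

text \<open>When the two top nodes are consecutive, this also contains all neighbours of the nodes
  strictly between the paths, see \<open>strip_neighbours\<close>.\<close>

definition closed_strip :: "int \<Rightarrow> nat \<Rightarrow> (nat \<Rightarrow> int) \<Rightarrow> (nat \<Rightarrow> int) \<Rightarrow> (nat \<times> int) set" where
  "closed_strip N m P Q = strip m P Q \<union> regs N m (P m) \<union> regs N m (Q m)"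

text \<open>Going down a layer adds only the node itself to the registers; the rest is inherited
  from the parent, which lies in the strip again.\<close>

lemma strip_regs:
  assumes N: "0 < N" and P: "descending N m P" and Q: "descending N m Q" and PQ: "Q m \<le> P m + 1"
    and "m \<le> i" "P i \<le> v" "v \<le> Q i"
  shows "regs N i v \<subseteq> closed_strip N m P Q"
  using assms(5-)
proof (induction i arbitrary: v rule: dec_induct)
  case base
  then have "v = P m \<or> v = Q m" using PQ by linarith
  then show ?case by (auto simp: closed_strip_def)
next
  case (step i)
  have "P i = P (Suc i) div N" "Q i = Q (Suc i) div N" using P Q step by (auto simp: descending_def)
  then have "P i \<le> v div N" "v div N \<le> Q i" using step N by (auto intro: zdiv_mono1)
  then have "regs N i (v div N) \<subseteq> closed_strip N m P Q" using step.IH by blast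
  moreover have "(Suc i, v) \<in> closed_strip N m P Q" using step by (auto simp: closed_strip_def strip_def)
  ultimately show ?case using regs_Suc by blast
qed

lemma strip_neighbours:
  assumes N: "0 < N" and P: "descending N m P" and Q: "descending N m Q" and PQ: "Q m = P m + 1"
    and x: "m \<le> i" "P i < u" "u < Q i" and a: "adj N (i, u) y"
  shows "y \<in> closed_strip N m P Q"
proof -
  obtain j w where y: "y = (j, w)" by fastforce
  show ?thesis
  proof (cases "m \<le> j")
    case True
    have "\<not> w < P j" using trail_separates[OF N P x(1,2) True, of w] a y by blast
    moreover have "\<not> Q j < w"
      using trail_separates[OF N Q True, of w i u] x a y adj_sym by blast
    ultimately show ?thesis using True y by (auto simp: closed_strip_def strip_def)
  next
    case False
    \<comment> \<open>No integer lies strictly between \<open>P m\<close> and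
      \<open>P m + 1\<close>, so the node is in a later layer and its parent still lies in the
      strip.\<close>
    have "i \<noteq> m" using x PQ by auto
    then obtain i' where i: "i = Suc i'" "m \<le> i'" using x(1) by (cases i) auto
    have "y \<in> ups N (i, u)" using a False x(1) y ups_layer[of "(i,u)" N y] by (auto simp: adj_def)
    then have "y \<in> regs N i' (u div N)" using i ups_subset_regs by blast
    moreover have "P i' = P i div N" "Q i' = Q i div N" using P Q i by (auto simp: descending_def)
    then have "P i' \<le> u div N" "u div N \<le> Q i'" using x N by (auto intro: zdiv_mono1)
    ultimately show ?thesis using strip_regs[OF N P Q _ i(2)] PQ by auto
  qed
qed

text \<open>
  \<open>Q\<close> stands for the registers of the nodes in the previous layer: nodes of layer \<open>m\<close> below it have no
  other registers but themselves, so \<open>Q\<close> and the two outermost paths can be kept in all bags.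
\<close>

lemma strip_sequence:
  assumes N: "0 < N" and fin: "finite X" and ab: "a \<le> b"
    and P: "\<And>c. a \<le> c \<Longrightarrow> c \<le> b \<Longrightarrow> descending N m (P c)"
      "\<And>c. a \<le> c \<Longrightarrow> c \<le> b \<Longrightarrow> P c m = c"
      "\<And>c. a \<le> c \<Longrightarrow> c \<le> b \<Longrightarrow> card (X \<inter> trail m (P c)) \<le> D"
    and Q: "\<And>x. x \<in> Q \<Longrightarrow> fst x < m" 
    and rQ: "\<And>c. a \<le> c \<Longrightarrow> c \<le> b \<Longrightarrow> regs N m c \<subseteq> insert (m, c) Q"
    and strips: "\<And>c. a \<le> c \<Longrightarrow> c < b \<Longrightarrow>
      rooted_decomp (adj N) k (X \<inter> closed_strip N m (P c) (P (c + 1)))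
        (X \<inter> (regs N m c \<union> regs N m (c + 1) \<union> trail m (P c) \<union> trail m (P (c + 1))))"
    and k: "card (X \<inter> Q) + 4 * D \<le> k"
  shows "rooted_decomp (adj N) k (X \<inter> (Q \<union> strip m (P a) (P b)))
           (X \<inter> (Q \<union> trail m (P a) \<union> trail m (P b)))"
proof -
  define Z where "Z = Q \<union> trail m (P a) \<union> trail m (P b)"
  have mono: "P c i \<le> P d i" if "a \<le> c" "c \<le> d" "d \<le> b" "m \<le> i" for c d i
  proof (cases "c = d")
    case False
    then show ?thesis using descending_less[OF N P(1) P(1), of c d i] P(2) that by force
  qed simp
  \<comment> \<open>The strips are added from left to right; besides \<open>Z\<close> only the last
    path stays in the root bag.\<close>
  have "c \<le> b \<longrightarrow> rooted_decomp (adj N) k (X \<inter> (Z \<union> strip m (P a) (P c))) (X \<inter> (Z \<union> trail m (P c)))"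
    if "a \<le> c" for c
    using that
  proof (induction rule: int_ge_induct)
    case base
    have "strip m (P a) (P a) = trail m (P a)" by (auto simp: strip_def trail_def)
    then have *: "X \<inter> (Z \<union> strip m (P a) (P a)) = X \<inter> (Z \<union> trail m (P a))" by simp
    have "X \<inter> (Z \<union> trail m (P a)) = (X \<inter> Q) \<union> ((X \<inter> trail m (P a)) \<union> (X \<inter> trail m (P b)))"
      by (auto simp: Z_def)
    then have "card (X \<inter> (Z \<union> trail m (P a))) \<le> card (X \<inter> Q) + (card (X \<inter> trail m (P a)) + card (X \<inter> trail m (P b)))"
      by (metis (no_types, lifting) add_left_mono card_Un_le le_trans)
    also have "\<dots> \<le> k" using P(3)[of a] P(3)[of b] ab k by simp
    finally show ?case unfolding * by (intro impI rooted_decomp_bag)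
  next
    case (step c)
    show ?case
    proof
      assume cb: "c + 1 \<le> b"
      let ?W1 = "X \<inter> (Z \<union> strip m (P a) (P c))"
      let ?W2 = "X \<inter> (Z \<union> strip m (P c) (P (c + 1)))"
      let ?W = "X \<inter> closed_strip N m (P c) (P (c + 1))"
      let ?\<beta> = "X \<inter> (Z \<union> trail m (P c))"
      let ?\<beta>' = "X \<inter> (Z \<union> trail m (P (c + 1)))"
      \<comment> \<open>The transition bag with both sides of the next strip. Its four paths account
        for the term \<open>4 * D\<close>.\<close>
      let ?\<gamma> = "X \<inter> (Z \<union> trail m (P c) \<union> trail m (P (c + 1)))"
      have c: "a \<le> c" "c < b" "c \<le> b" "a \<le> c + 1" using step cb by auto
      note Pc = P(1)[OF c(1,3)] P(1)[OF c(4) cb]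
      have m1: "P a i \<le> P c i" "P c i \<le> P (c + 1) i" "P (c + 1) i \<le> P b i" if "m \<le> i" for i
        using mono[OF _ _ _ that] c cb by auto
      have regsZ: "regs N m c \<subseteq> insert (m, c) Z" "regs N m (c + 1) \<subseteq> insert (m, c + 1) Z"
        using rQ[OF c(1,3)] rQ[OF c(4) cb] by (auto simp: Z_def)
      have start: "(m, c) \<in> trail m (P c)" "(m, c + 1) \<in> trail m (P (c + 1))"
        using P(2)[OF c(1,3)] P(2)[OF c(4) cb] unfolding trail_def by force+
      have tr: "trail m (P c) \<subseteq> strip m (P c) (P (c + 1))" "trail m (P (c + 1)) \<subseteq> strip m (P c) (P (c + 1))"
        "trail m (P c) \<subseteq> strip m (P a) (P c)" "trail m (P a) \<subseteq> strip m (P a) (P c)"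
        using m1 by (auto simp: trail_def strip_def)
      have cl: "closed_strip N m (P c) (P (c + 1)) \<subseteq> Z \<union> strip m (P c) (P (c + 1))"
        using regsZ start tr P(2)[OF c(1,3)] P(2)[OF c(4) cb] by (auto simp: closed_strip_def)
      have cardg: "card ?\<gamma> \<le> k"
      proof -
        have "?\<gamma> = (X \<inter> Q) \<union> (((X \<inter> trail m (P a)) \<union> (X \<inter> trail m (P b))) \<union>
          ((X \<inter> trail m (P c)) \<union> (X \<inter> trail m (P (c + 1)))))"
          by (auto simp: Z_def)
        then have "card ?\<gamma> \<le> card (X \<inter> Q) + ((card (X \<inter> trail m (P a)) + card (X \<inter> trail m (P b))) +
          (card (X \<inter> trail m (P c)) + card (X \<inter> trail m (P (c + 1)))))"
          by (simp only: card_Un5)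
        then show ?thesis
          using P(3)[of a] P(3)[of b] P(3)[OF c(1,3)] P(3)[OF c(4) cb] ab k by simp
      qed
      have "rooted_decomp (adj N) k (?W \<union> ?\<gamma>) ?\<gamma>"
      proof (rule rooted_decomp_reroot[OF strips[OF c(1,2)]])
        show "card ?\<gamma> \<le> k" by (rule cardg)
        show "?W \<inter> ?\<gamma> \<subseteq> X \<inter> (regs N m c \<union> regs N m (c + 1) \<union> trail m (P c) \<union> trail m (P (c + 1)))"
        proof
          fix x assume x: "x \<in> ?W \<inter> ?\<gamma>"
          show "x \<in> X \<inter> (regs N m c \<union> regs N m (c + 1) \<union> trail m (P c) \<union> trail m (P (c + 1)))"
          proof (cases "x \<in> strip m (P c) (P (c + 1))")
            case False
            then show ?thesis using x P(2)[OF c(1,3)] P(2)[OF c(4) cb] by (auto simp: closed_strip_def)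
          next
            case True
            then obtain i u where iu: "x = (i, u)" "m \<le> i" "P c i \<le> u" "u \<le> P (c + 1) i"
              by (auto simp: strip_def)
            \<comment> \<open>\<open>Q\<close> lies in earlier layers and the outermost paths do not
              enter the interior of the strip, so only its two sides remain.\<close>
            have "x \<notin> Q" using Q[of x] iu by auto
            then have "u = P c i \<or> u = P (c + 1) i"
              using x iu m1[OF iu(2)] by (auto simp: Z_def trail_def)
            then show ?thesis using x iu by (auto simp: trail_def)
          qed
        qed
        fix x y assume x: "x \<in> ?W - ?\<gamma>" and y: "y \<in> ?\<gamma> - ?W"
        have "x \<in> strip m (P c) (P (c + 1))" using x cl by blast
        then obtain i u where iu: "x = (i, u)" "m \<le> i" "P c i \<le> u" "u \<le> P (c + 1) i"
          by (auto simp: strip_def)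
        then have "P c i < u" "u < P (c + 1) i" using x by (force simp: trail_def)+
        then have "\<not> adj N x y"
          using strip_neighbours[OF N Pc, of i u y] iu P(2)[OF c(1,3)] P(2)[OF c(4) cb] y by auto
        then show "\<not> adj N x y \<and> \<not> adj N y x" using adj_sym by blast
      qed
      moreover have "?W \<union> ?\<gamma> = ?W2" using cl tr by (auto simp: closed_strip_def)
      ultimately have d2: "rooted_decomp (adj N) k ?W2 ?\<gamma>" by simp
      have d1: "rooted_decomp (adj N) k ?W1 ?\<beta>" using step c by simp
      have "rooted_decomp (adj N) k (?W2 \<union> ?W1) ?\<gamma>"
      proof (rule rooted_decomp_glue[OF d2 d1])
        have "strip m (P c) (P (c + 1)) \<inter> strip m (P a) (P c) \<subseteq> trail m (P c)"
          by (auto simp: strip_def trail_def)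
        then show "?W2 \<inter> ?W1 \<subseteq> ?\<gamma>" "?W2 \<inter> ?W1 \<subseteq> ?\<beta>" by blast+
        fix x y assume x: "x \<in> ?W2 - ?W1" and y: "y \<in> ?W1 - ?W2"
        have "x \<in> strip m (P c) (P (c + 1))" "x \<notin> trail m (P c)" using x tr by blast+
        then obtain i u where iu: "x = (i, u)" "m \<le> i" "P c i < u"
          by (force simp: strip_def trail_def)
        have "y \<in> strip m (P a) (P c)" "y \<notin> trail m (P c)" using y tr by blast+
        then obtain j w where jw: "y = (j, w)" "m \<le> j" "w < P c j"
          by (force simp: strip_def trail_def)
        have "\<not> adj N x y" using trail_separates[OF N Pc(1)] iu jw by blast
        then show "\<not> adj N x y \<and> \<not> adj N y x" using adj_sym by blast
      qed
      \<comment> \<open>The smaller root bag drops the path of \<open>c\<close>.\<close>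
      then have "rooted_decomp (adj N) k ((?W2 \<union> ?W1) \<union> ?\<beta>') ?\<beta>'"
      proof (rule rooted_decomp_reroot)
        have "card ?\<beta>' \<le> card ?\<gamma>" using fin by (intro card_mono) auto
        then show "card ?\<beta>' \<le> k" using cardg by simp
      qed (use tr in blast)+
      moreover have "(?W2 \<union> ?W1) \<union> ?\<beta>' = X \<inter> (Z \<union> strip m (P a) (P (c + 1)))"
      proof -
        have "strip m (P a) (P (c + 1)) = strip m (P a) (P c) \<union> strip m (P c) (P (c + 1))"
          using m1 by (force simp: strip_def)
        then show ?thesis using tr by blast
      qed
      ultimately show "rooted_decomp (adj N) k (X \<inter> (Z \<union> strip m (P a) (P (c + 1)))) ?\<beta>'" by simp
    qed
  qed
  from this[OF ab] have *: "rooted_decomp (adj N) k (X \<inter> (Z \<union> strip m (P a) (P b))) (X \<inter> (Z \<union> trail m (P b)))"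
    by simp
  have "Z \<union> strip m (P a) (P b) = Q \<union> strip m (P a) (P b)"
    using mono[OF _ ab] by (auto simp: Z_def strip_def trail_def)
  moreover have "Z \<union> trail m (P b) = Q \<union> trail m (P a) \<union> trail m (P b)" by (auto simp: Z_def)
  ultimately show ?thesis using * by simp
qed

text \<open>Induction on the number of remaining layers. In layer \<open>Suc m\<close> the strip is
  cut by paths through all nodes from \<open>L (Suc m)\<close> to \<open>R (Suc m)\<close>, and
  \<open>strip_sequence\<close> assembles the narrower strips. The bound adds the registers of two
  nodes to four paths.\<close>

lemma strip_decomp:
  assumes N: "0 < N" and fin: "finite X" and Xn: "X \<subseteq> {..n} \<times> UNIV"
    and paths: "\<And>m c. \<exists>P. descending N m P \<and> P m = c \<and> card (X \<inter> trail m P) \<le> D"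
    and k: "2 * (t + 1) + 4 * D \<le> k"
    and L: "descending N m L" "card (X \<inter> trail m L) \<le> D"
    and R: "descending N m R" "card (X \<inter> trail m R) \<le> D"
    and LR: "R m = L m + 1"
  shows "rooted_decomp (adj N) k (X \<inter> closed_strip N m L R)
           (X \<inter> (regs N m (L m) \<union> regs N m (R m) \<union> trail m L \<union> trail m R))"
  using L R LR
proof (induction "Suc n - m" arbitrary: m L R)
  have cQ: "card (X \<inter> (regs N m u \<union> regs N m v)) \<le> 2 * (t + 1)" for m u v
  proof -
    have "card (X \<inter> (regs N m u \<union> regs N m v)) \<le> card (regs N m u \<union> regs N m v)"
      by (intro card_mono) (auto simp: finite_regs)
    also have "\<dots> \<le> card (regs N m u) + card (regs N m v)" by (rule card_Un_le)
    also have "\<dots> \<le> 2 * (t + 1)" using card_regs[of N m u] card_regs[of N m v] by simp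
    finally show ?thesis .
  qed
  {
    \<comment> \<open>Layer \<open>m\<close> lies beyond all of \<open>X\<close>, so only registers
      remain.\<close>
    case 0
    then have "X \<inter> strip m L R = {}" "X \<inter> trail m L = {}" "X \<inter> trail m R = {}"
      using Xn by (auto simp: strip_def trail_def)
    then have "X \<inter> closed_strip N m L R = X \<inter> (regs N m (L m) \<union> regs N m (R m))"
      "X \<inter> (regs N m (L m) \<union> regs N m (R m) \<union> trail m L \<union> trail m R) = X \<inter> (regs N m (L m) \<union> regs N m (R m))"
      by (auto simp: closed_strip_def)
    then show ?case using cQ[of m "L m" "R m"] k by (simp add: rooted_decomp_bag)
  next
    case (Suc d)
    let ?a = "L (Suc m)" and ?b = "R (Suc m)"
    let ?Q = "regs N m (L m) \<union> regs N m (R m)"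
    have div: "?a div N = L m" "?b div N = R m" using Suc.prems by (auto simp: descending_def)
    then have ab: "?a < ?b" using Suc.prems(5) N div_less_imp_less[of N ?a ?b] by simp
    \<comment> \<open>The outer paths must be the given \<open>L\<close> and \<open>R\<close>; the
      intermediate ones are chosen freely.\<close>
    define P where "P c = (if c = ?a then L else if c = ?b then R else
      (SOME P. descending N (Suc m) P \<and> P (Suc m) = c \<and> card (X \<inter> trail (Suc m) P) \<le> D))" for c
    have sub: "trail (Suc m) P \<subseteq> trail m P" for P by (auto simp: trail_def)
    have cs: "card (X \<inter> trail (Suc m) P) \<le> card (X \<inter> trail m P)" for P
      using fin sub by (intro card_mono) auto
    have P: "descending N (Suc m) (P c) \<and> P c (Suc m) = c \<and> card (X \<inter> trail (Suc m) (P c)) \<le> D" for c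
    proof -
      consider "c = ?a" | "c = ?b" "c \<noteq> ?a" | "c \<noteq> ?a" "c \<noteq> ?b" by blast
      then show ?thesis
      proof cases
        case 1
        then show ?thesis using Suc.prems(1,2) cs[of L] by (auto simp: P_def descending_def)
      next
        case 2
        then show ?thesis using Suc.prems(3,4) cs[of R] by (auto simp: P_def descending_def)
      next
        case 3
        then show ?thesis using someI_ex[OF paths[of "Suc m" c]] by (simp add: P_def)
      qed
    qed
    have PaPb: "P ?a = L" "P ?b = R" using ab by (auto simp: P_def)
    have "rooted_decomp (adj N) k (X \<inter> (?Q \<union> strip (Suc m) (P ?a) (P ?b)))
           (X \<inter> (?Q \<union> trail (Suc m) (P ?a) \<union> trail (Suc m) (P ?b)))"
    proof (rule strip_sequence[OF N fin, where D = D])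
      show "?a \<le> ?b" using ab by simp
      show "fst x < Suc m" if "x \<in> ?Q" for x using that regs_layer le_imp_less_Suc by blast
      show "regs N (Suc m) c \<subseteq> insert (Suc m, c) ?Q" if "?a \<le> c" "c \<le> ?b" for c
      proof -
        \<comment> \<open>The parent of such a node is one of the two top nodes, so inherited
          registers lie in \<open>?Q\<close>.\<close>
        have "L m \<le> c div N" "c div N \<le> R m" using that div N zdiv_mono1 by metis+
        then have "c div N = L m \<or> c div N = R m" using Suc.prems(5) by linarith
        then show ?thesis using regs_Suc[of N m c] by auto
      qed
      show "rooted_decomp (adj N) k (X \<inter> closed_strip N (Suc m) (P c) (P (c + 1)))
        (X \<inter> (regs N (Suc m) c \<union> regs N (Suc m) (c + 1) \<union> trail (Suc m) (P c) \<union> trail (Suc m) (P (c + 1))))"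
        for c
        using Suc.hyps(1)[of "Suc m" "P c" "P (c + 1)"] Suc.hyps(2) P[of c] P[of "c + 1"] by simp
      show "card (X \<inter> ?Q) + 4 * D \<le> k" using cQ[of m "L m" "R m"] k by simp
    qed (use P in auto)
    moreover have "?Q \<union> strip (Suc m) L R = closed_strip N m L R"
    proof -
      have "strip m L R = {(m, L m), (m, R m)} \<union> strip (Suc m) L R"
        using Suc.prems(5) by (force simp: strip_def le_Suc_eq Suc_le_eq order_le_less)
      then show ?thesis using self_in_regs by (auto simp: closed_strip_def)
    qed
    moreover have "trail m P = insert (m, P m) (trail (Suc m) P)" for P
      by (force simp: trail_def Suc_le_eq order_le_less)
    then have "?Q \<union> trail (Suc m) L \<union> trail (Suc m) R = ?Q \<union> trail m L \<union> trail m R"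
      using self_in_regs by auto
    ultimately show ?case unfolding PaPb by simp
  }
qed

section \<open>From strips to the whole vertex set\<close>

primrec root :: "int \<Rightarrow> nat \<Rightarrow> int \<Rightarrow> int" where
  "root N 0 v = v"
| "root N (Suc m) v = root N m (v div N)"

lemma root_right: "0 < N \<Longrightarrow> descending N 0 P \<Longrightarrow> P 0 < root N i v \<Longrightarrow> P i < v"
proof (induction i arbitrary: v)
  case (Suc i)
  then have "P (Suc i) div N < v div N" by (simp add: descending_def)
  then show ?case using Suc.prems div_less_imp_less by blast
qed simp

lemma root_left: "0 < N \<Longrightarrow> descending N 0 P \<Longrightarrow> root N i v < P 0 \<Longrightarrow> v < P i"
proof (induction i arbitrary: v)
  case (Suc i)
  then have "v div N < P (Suc i) div N" by (simp add: descending_def)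
  then show ?case using Suc.prems div_less_imp_less by blast
qed simp

text \<open>Layer 0 extends to both sides, so paths starting outside the layer-0 ancestors of
  \<open>X\<close> enclose \<open>X\<close>. The strips between them are assembled by
  \<open>strip_sequence\<close> with empty \<open>Q\<close>.\<close>

lemma decomp_of_paths:
  assumes N: "0 < N" and fin: "finite X" and Xn: "X \<subseteq> {..n} \<times> UNIV"
    and paths: "\<And>m c. \<exists>P. descending N m P \<and> P m = c \<and> card (X \<inter> trail m P) \<le> D"
    and k: "2 * (t + 1) + 4 * D \<le> k"
  shows "\<exists>R. rooted_decomp (adj N) k X R"
proof -
  \<comment> \<open>The element 0 makes \<open>Min\<close> and \<open>Max\<close> meaningful for
    empty \<open>X\<close>.\<close>
  let ?r = "insert 0 ((\<lambda>(i, v). root N i v) ` X)"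
  let ?a = "Min ?r - 1" and ?b = "Max ?r + 1"
  have ra: "?a < root N i v" "root N i v < ?b" if "(i, v) \<in> X" for i v
  proof -
    have "root N i v \<in> ?r" using that by force
    then have "Min ?r \<le> root N i v" "root N i v \<le> Max ?r" using fin by (auto intro: Min_le Max_ge)
    then show "?a < root N i v" "root N i v < ?b" by linarith+
  qed
  have "Min ?r \<le> Max ?r" using fin by (intro Min_le_iff[THEN iffD2]) (auto intro!: bexI[of _ 0])
  then have ab: "?a \<le> ?b" by linarith
  obtain P where P: "\<And>c. descending N 0 (P c) \<and> P c 0 = c \<and> card (X \<inter> trail 0 (P c)) \<le> D"
    using paths[of 0] by metis
  have "rooted_decomp (adj N) k (X \<inter> ({} \<union> strip 0 (P ?a) (P ?b)))
      (X \<inter> ({} \<union> trail 0 (P ?a) \<union> trail 0 (P ?b)))"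
  proof (rule strip_sequence[OF N fin ab, where D = D])
    show "regs N 0 c \<subseteq> insert (0, c) {}" for c by (simp add: regs_0)
    show "rooted_decomp (adj N) k (X \<inter> closed_strip N 0 (P c) (P (c + 1)))
      (X \<inter> (regs N 0 c \<union> regs N 0 (c + 1) \<union> trail 0 (P c) \<union> trail 0 (P (c + 1))))" for c
      using strip_decomp[OF N fin Xn paths k, of 0 "P c" "P (c + 1)"] P[of c] P[of "c + 1"] by simp
  qed (use P k in auto)
  moreover have "X \<subseteq> strip 0 (P ?a) (P ?b)"
  proof
    fix x assume x: "x \<in> X"
    obtain i v where iv: "x = (i, v)" by fastforce
    have "P ?a i < v" "v < P ?b i"
      using root_right[OF N, of "P ?a" i v] root_left[OF N, of "P ?b" i v] P ra x iv by auto
    then show "x \<in> strip 0 (P ?a) (P ?b)" using iv by (auto simp: strip_def)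
  qed
  then have "X \<inter> ({} \<union> strip 0 (P ?a) (P ?b)) = X" by auto
  ultimately show ?thesis by metis
qed

end

section \<open>Embedding graphs of treewidth at most t\<close>

text \<open>
  A graph of treewidth at most \<open>t\<close> arises by adding vertices one at a time, the earlier neighbours of a
  new vertex being among at most \<open>t\<close> vertices of an earlier bag. The bound \<open>t\<close> leaves one of \<open>t + 1\<close>
  registers free for the new vertex.
\<close>

inductive built :: "nat \<Rightarrow> 'a set set \<Rightarrow> 'a set \<Rightarrow> 'a set set \<Rightarrow> bool" for t E where
  empty: "built t E {} {{}}"
| insert: "built t E V Bs \<Longrightarrow> b \<in> Bs \<Longrightarrow> \<beta> \<subseteq> b \<Longrightarrow> card \<beta> \<le> t \<Longrightarrow> h \<notin> V \<Longrightarrow>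
    (\<And>u. u \<in> V \<Longrightarrow> {h, u} \<in> E \<Longrightarrow> u \<in> \<beta>) \<Longrightarrow>
    built t E (insert h V) (insert (insert h \<beta>) Bs)"

lemma built_finite: "built t E V Bs \<Longrightarrow> finite V \<and> (\<forall>b\<in>Bs. b \<subseteq> V)"
  by (induction rule: built.induct) auto

text \<open>The vertices of \<open>b\<close> outside \<open>V\<close> are added one at a time. Each
  is attached to the part of \<open>b\<close> already present, which has at most \<open>t\<close>
  vertices because the new one is missing from it.\<close>

lemma built_add_bag:
  assumes "finite b" "card b \<le> t + 1"
    and "built t E V Bs" "c \<in> Bs" "b \<inter> V \<subseteq> c"
    and "\<And>u w. u \<in> b - V \<Longrightarrow> w \<in> V \<Longrightarrow> {u, w} \<in> E \<Longrightarrow> w \<in> b"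
  shows "\<exists>Bs'. Bs \<subseteq> Bs' \<and> built t E (V \<union> b) Bs' \<and> (\<exists>c'\<in>Bs'. b \<subseteq> c')"
  using assms(3-)
proof (induction "card (b - V)" arbitrary: V Bs c)
  case 0
  then have "b \<subseteq> V" using assms(1) by simp
  then have "V \<union> b = V" "b \<subseteq> c" using 0 by auto
  then show ?case using 0 by auto
next
  case (Suc d)
  then obtain h where h: "h \<in> b" "h \<notin> V" by (metis Diff_iff card.empty equals0I nat.distinct(1))
  let ?\<beta> = "b \<inter> V" and ?V = "insert h V"
  let ?Bs = "insert (insert h ?\<beta>) Bs"
  have "card ?\<beta> < card b" using h assms(1) by (intro psubset_card_mono) auto
  then have bt: "built t E ?V ?Bs" using Suc.prems h assms(2) by (intro built.insert[of t E V Bs c]) auto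
  have "b - V = insert h (b - ?V)" using h by auto
  then have "card (b - V) = Suc (card (b - ?V))" using assms(1) by (metis Diff_iff card_insert_disjoint finite_Diff insertI1)
  then have d: "d = card (b - ?V)" using Suc.hyps(2) by simp
  have c: "insert h ?\<beta> \<in> ?Bs" "b \<inter> ?V \<subseteq> insert h ?\<beta>" by auto
  have e: "w \<in> b" if "u \<in> b - ?V" "w \<in> ?V" "{u, w} \<in> E" for u w
    using that h Suc.prems(4) by auto
  have "\<exists>Bs'. ?Bs \<subseteq> Bs' \<and> built t E (?V \<union> b) Bs' \<and> (\<exists>c'\<in>Bs'. b \<subseteq> c')"
    by (rule Suc.hyps(1)[OF d bt c]) (rule e)
  then obtain Bs' where "?Bs \<subseteq> Bs'" "built t E (?V \<union> b) Bs'" "\<exists>c'\<in>Bs'. b \<subseteq> c'"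
    by blast
  moreover have "?V \<union> b = V \<union> b" using h by auto
  ultimately show ?case by (metis insert_subset)
qed

lemma rip_imp_built:
  assumes "rip bs" "\<And>b. b \<in> set bs \<Longrightarrow> finite b \<and> card b \<le> t + 1"
    and "\<And>u v. u \<in> \<Union>(set bs) \<Longrightarrow> v \<in> \<Union>(set bs) \<Longrightarrow> {u, v} \<in> E \<Longrightarrow> \<exists>b\<in>set bs. u \<in> b \<and> v \<in> b"
  shows "\<exists>Bs. built t E (\<Union>(set bs)) Bs \<and> (\<forall>b\<in>set bs. \<exists>c\<in>Bs. b \<subseteq> c)"
  using assms
proof (induction rule: rip.induct)
  case (single b)
  then show ?case using built_add_bag[of b t E "{}" "{{}}" "{}"] built.empty[of t E] by auto
next
  case (snoc bs c b)
  let ?V = "\<Union>(set bs)"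
  have "\<exists>b\<in>set bs. u \<in> b \<and> v \<in> b" if "u \<in> ?V" "v \<in> ?V" "{u, v} \<in> E" for u v
  proof -
    have "\<exists>b'\<in>set (bs @ [b]). u \<in> b' \<and> v \<in> b'"
      using that by (intro snoc.prems(2)) auto
    then obtain b' where "b' \<in> set (bs @ [b])" "u \<in> b'" "v \<in> b'" by blast
    \<comment> \<open>If \<open>b'\<close> is the new bag, both ends are old and lie in
      \<open>b \<inter> ?V\<close>, hence in \<open>c\<close>.\<close>
    then show ?thesis using that snoc.hyps by (cases "b' \<in> set bs") auto
  qed
  then obtain Bs where Bs: "built t E ?V Bs" "\<forall>b\<in>set bs. \<exists>c\<in>Bs. b \<subseteq> c"
    using snoc.IH snoc.prems(1) by auto
  then obtain c' where c': "c' \<in> Bs" "c \<subseteq> c'" using snoc.hyps by blast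
  have e: "w \<in> b" if "u \<in> b - ?V" "w \<in> ?V" "{u, w} \<in> E" for u w
  proof -
    have "\<exists>b'\<in>set (bs @ [b]). u \<in> b' \<and> w \<in> b'"
      using that by (intro snoc.prems(2)) auto
    then obtain b' where "b' \<in> set (bs @ [b])" "u \<in> b'" "w \<in> b'" by blast
    then show ?thesis using that by auto
  qed
  have fb: "finite b" "card b \<le> t + 1" "b \<inter> ?V \<subseteq> c'"
    using snoc.prems(1)[of b] snoc.hyps(3) c'(2) by auto
  have "\<exists>Bs'. Bs \<subseteq> Bs' \<and> built t E (?V \<union> b) Bs' \<and> (\<exists>c'\<in>Bs'. b \<subseteq> c')"
    by (rule built_add_bag[OF fb(1,2) Bs(1) c'(1) fb(3)]) (rule e)
  then obtain Bs' where "Bs \<subseteq> Bs'" "built t E (?V \<union> b) Bs'" "\<exists>c'\<in>Bs'. b \<subseteq> c'" by blast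
  moreover have "?V \<union> b = \<Union>(set (bs @ [b]))" by auto
  moreover have "\<exists>c\<in>Bs'. d \<subseteq> c" if "d \<in> set (bs @ [b])" for d
  proof (cases "d = b")
    case False
    then have "d \<in> set bs" using that by simp
    then show ?thesis using Bs(2) \<open>Bs \<subseteq> Bs'\<close> by blast
  qed (use \<open>\<exists>c'\<in>Bs'. b \<subseteq> c'\<close> in simp)
  ultimately show ?case by metis
qed

lemma tw_le_imp_built:
  assumes "tw_le G t" "wf_graph G"
  obtains Bs where "built t (edges G) (verts G) Bs"
proof -
  obtain bs where bs: "rip bs" "\<Union>(set bs) = verts G" "\<And>b. b \<in> set bs \<Longrightarrow> card b \<le> t + 1"
    "\<And>e. e \<in> edges G \<Longrightarrow> \<exists>b\<in>set bs. e \<subseteq> b"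
    using tw_le_imp_rip assms by metis
  have "finite b" if "b \<in> set bs" for b
    using that bs(2) assms(2) by (auto simp: wf_graph_def intro: finite_subset)
  then have "\<exists>Bs. built t (edges G) (\<Union>(set bs)) Bs \<and> (\<forall>b\<in>set bs. \<exists>c\<in>Bs. b \<subseteq> c)"
    using bs(3,4) by (intro rip_imp_built[OF bs(1)]) fastforce+
  then show ?thesis using that bs(2) by auto
qed

context register_wheel
begin

section \<open>Chains of nodes of one type\<close>

text \<open>The child of \<open>x\<close> of odd index \<open>2 * j + 1\<close>; it has type
  \<open>j\<close> as long as this index is below \<open>N\<close>.\<close>

definition step :: "int \<Rightarrow> nat \<Rightarrow> nat \<times> int \<Rightarrow> nat \<times> int" where
  "step N j x = (Suc (fst x), snd x * N + (2 * int j + 1))"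

abbreviation chain :: "int \<Rightarrow> nat \<Rightarrow> nat \<Rightarrow> nat \<times> int \<Rightarrow> nat \<times> int" where
  "chain N j r \<equiv> step N j ^^ r"

lemma fst_step [simp]: "fst (step N j x) = Suc (fst x)"
  by (simp add: step_def)

lemma fst_chain [simp]: "fst (chain N j r x) = fst x + r"
  by (induction r) auto

lemma step_div: "2 * int j + 1 < N \<Longrightarrow> snd (step N j x) div N = snd x"
  by (simp add: step_def)

lemma step_mod: "2 * int j + 1 < N \<Longrightarrow> snd (step N j x) mod N = 2 * int j + 1"
  by (simp add: step_def)

lemma tp_step: "2 * int j + 1 < N \<Longrightarrow> tp N (snd (step N j x)) = j"
  by (simp add: tp_def step_mod nat_add_distrib nat_mult_distrib)

lemma reg_step:
  "2 * int j + 1 < N \<Longrightarrow> reg N (fst (step N j x)) (snd (step N j x)) s =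
     (if s = slot j then step N j x else reg N (fst x) (snd x) s)"
  by (simp add: step_div tp_step prod_eq_iff)

lemma reg_chain:
  "2 * int j + 1 < N \<Longrightarrow> s \<noteq> slot j \<Longrightarrow>
    reg N (fst (chain N j r x)) (snd (chain N j r x)) s = reg N (fst x) (snd x) s"
  by (induction r) (simp_all add: reg_step del: fst_step fst_chain reg.simps)

lemma ups_step:
  assumes "2 * int j + 1 < N"
  shows "ups N (step N j x) = reg N (fst x) (snd x) ` sel j"
proof -
  have "step N j x = (Suc (fst x), snd (step N j x))" by (simp add: prod_eq_iff)
  then have "ups N (step N j x) = ups N (Suc (fst x), snd (step N j x))" by simp
  then show ?thesis using assms by (simp add: step_div tp_step)
qed

text \<open>Only register \<open>slot j\<close> changes along the chain and it is not selected, so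
  all nodes after \<open>x\<close> have the same earlier neighbours. The embedding may thus wait for
  a node of \<open>X\<close>.\<close>

lemma ups_chain:
  assumes "2 * int j + 1 < N" "slot j \<notin> sel j"
  shows "ups N (chain N j (Suc r) x) = reg N (fst x) (snd x) ` sel j"
proof -
  have "ups N (chain N j (Suc r) x) = reg N (fst (chain N j r x)) (snd (chain N j r x)) ` sel j"
    using ups_step[OF assms(1)] by (simp del: fst_chain)
  also have "\<dots> = reg N (fst x) (snd x) ` sel j"
    using assms by (intro image_cong refl reg_chain) auto
  finally show ?thesis .
qed

text \<open>
  All nodes on a chain overwrite the same register, so the other registers keep the vertices
  embedded so far. Thus \<open>good N J X e x\<close> says that from the bag stored at \<open>x\<close> the embedding can be
  continued in \<open>X\<close> for \<open>e\<close> rounds, with every type in \<open>J\<close> available in each round.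
\<close>

primrec good :: "int \<Rightarrow> nat set \<Rightarrow> (nat \<times> int) set \<Rightarrow> nat \<Rightarrow> nat \<times> int \<Rightarrow> bool" where
  "good N J X 0 x \<longleftrightarrow> True"
| "good N J X (Suc e) x \<longleftrightarrow>
     (\<forall>j\<in>J. \<exists>r. chain N j (Suc r) x \<in> X \<and> good N J X e (chain N j (Suc r) x))"

lemma good_Suc_imp_good: "good N J X (Suc e) x \<Longrightarrow> good N J X e x"
proof (induction e arbitrary: x)
  case (Suc e)
  show ?case unfolding good.simps(2)[of _ _ _ e x]
  proof
    fix j assume "j \<in> J"
    then obtain r where "chain N j (Suc r) x \<in> X" "good N J X (Suc e) (chain N j (Suc r) x)"
      using Suc.prems unfolding good.simps(2)[of _ _ _ "Suc e" x] by blast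
    then show "\<exists>r. chain N j (Suc r) x \<in> X \<and> good N J X e (chain N j (Suc r) x)"
      using Suc.IH by blast
  qed
qed simp

text \<open>For a type \<open>j\<close> witnessing the failure, the path follows the chain of type
  \<open>j\<close> to its first node in \<open>X\<close>, where \<open>good\<close> fails with one
  round less, and continues by induction. Each round contributes at most one node of
  \<open>X\<close>; a chain missing \<open>X\<close> is itself the path.\<close>

lemma not_good_imp_path:
  assumes J: "\<And>j. j \<in> J \<Longrightarrow> 2 * int j + 1 < N" and fin: "finite X"
  shows "\<not> good N J X e (m, v) \<Longrightarrow>
    \<exists>P. descending N m P \<and> P m = v \<and> card (X \<inter> trail (Suc m) P) < e"
proof (induction e arbitrary: m v)
  case (Suc e)
  then obtain j where j: "j \<in> J"
    "\<And>r. chain N j (Suc r) (m, v) \<in> X \<Longrightarrow> \<not> good N J X e (chain N j (Suc r) (m, v))"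
    by auto
  define p where "p r = snd (chain N j r (m, v))" for r
  have p0: "p 0 = v" by (simp add: p_def)
  have pS: "p (Suc r) div N = p r" for r using step_div[OF J[OF j(1)]] by (simp add: p_def)
  have ch: "chain N j r (m, v) = (m + r, p r)" for r by (simp add: p_def prod_eq_iff)
  show ?case
  proof (cases "\<exists>r. chain N j (Suc r) (m, v) \<in> X")
    case False
    \<comment> \<open>\<open>p\<close> counts steps along the chain, whereas a path is indexed by
      layers.\<close>
    let ?P = "\<lambda>i. p (i - m)"
    have "descending N m ?P" using pS by (auto simp: descending_def Suc_diff_le)
    moreover have "X \<inter> trail (Suc m) ?P = {}"
    proof (rule ccontr)
      assume "X \<inter> trail (Suc m) ?P \<noteq> {}"
      then obtain i where i: "Suc m \<le> i" "(i, p (i - m)) \<in> X" by (auto simp: trail_def)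
      have "m + Suc (i - m - 1) = i" "Suc (i - m - 1) = i - m" using i(1) by auto
      then have "chain N j (Suc (i - m - 1)) (m, v) = (i, p (i - m))"
        unfolding ch[of "Suc (i - m - 1)"] by metis
      then show False using False i by metis
    qed
    ultimately show ?thesis using p0 by (intro exI[of _ ?P]) auto
  next
    case True
    define r where "r = (LEAST r. chain N j (Suc r) (m, v) \<in> X)"
    have r: "chain N j (Suc r) (m, v) \<in> X" using True unfolding r_def by (rule LeastI_ex)
    have less: "chain N j (Suc q) (m, v) \<notin> X" if "q < r" for q
      using that not_less_Least unfolding r_def by blast
    let ?M = "m + Suc r"
    obtain P where P: "descending N ?M P" "P ?M = p (Suc r)" "card (X \<inter> trail (Suc ?M) P) < e"
      using Suc.IH[of ?M "p (Suc r)"] j(2)[OF r] ch[of "Suc r"] by auto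
    define R where "R i = (if i \<le> m + r then p (i - m) else P i)" for i
    have "descending N m R"
      unfolding descending_def
    proof (intro allI impI)
      fix i assume i: "m \<le> i"
      consider "i < m + r" | "i = m + r" | "i > m + r" by linarith
      then show "R (Suc i) div N = R i"
      proof cases
        case 1 then show ?thesis using i pS by (simp add: R_def Suc_diff_le)
      next
        case 2 then show ?thesis using P(2) pS by (simp add: R_def)
      next
        case 3 then show ?thesis using P(1) by (simp add: R_def descending_def)
      qed
    qed
    moreover have "R m = v" using p0 by (simp add: R_def)
    moreover have "card (X \<inter> trail (Suc m) R) < Suc e"
    proof -
      have "X \<inter> trail (Suc m) R \<subseteq> insert (?M, p (Suc r)) (X \<inter> trail (Suc ?M) P)"
    proof
      fix x assume "x \<in> X \<inter> trail (Suc m) R"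
      then obtain i where i: "x = (i, R i)" "Suc m \<le> i" "(i, R i) \<in> X" by (auto simp: trail_def)
      consider "i \<le> m + r" | "i = ?M" | "i > ?M" by linarith
      then show "x \<in> insert (?M, p (Suc r)) (X \<inter> trail (Suc ?M) P)"
      proof cases
        case 1
        have q: "m + Suc (i - m - 1) = i" "Suc (i - m - 1) = i - m" "i - m - 1 < r" using i(2) 1 by auto
        then have "chain N j (Suc (i - m - 1)) (m, v) = (i, R i)"
          unfolding ch[of "Suc (i - m - 1)"] using 1 by (simp add: R_def)
        then show ?thesis using less[OF q(3)] i by simp
      next
        case 2 then show ?thesis using i P(2) by (simp add: R_def)
      next
        case 3 then show ?thesis using i by (auto simp: R_def trail_def)
      qed
    qed
    then have "card (X \<inter> trail (Suc m) R) \<le> card (insert (?M, p (Suc r)) (X \<inter> trail (Suc ?M) P))"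
      using fin by (intro card_mono) auto
    also have "\<dots> \<le> Suc (card (X \<inter> trail (Suc ?M) P))" by (rule card_insert_le_m1) simp_all
    also have "\<dots> < Suc e" using P(3) by simp
    finally show ?thesis .
    qed
    ultimately show ?thesis by blast
  qed
qed simp

section \<open>Adjacency among nodes reached by chains\<close>

text \<open>\<open>U\<close> records the types used. The index of a node reveals its last type, so a
  node reached by a type outside \<open>U\<close> is new.\<close>

inductive_set below :: "int \<Rightarrow> nat set \<Rightarrow> nat \<times> int \<Rightarrow> (nat \<times> int) set" for N U x0 where
  start: "x0 \<in> below N U x0"
| step: "x \<in> below N U x0 \<Longrightarrow> j \<in> U \<Longrightarrow> step N j x \<in> below N U x0"

lemma below_mono: "U \<subseteq> U' \<Longrightarrow> x \<in> below N U x0 \<Longrightarrow> x \<in> below N U' x0"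
  by (rotate_tac, induction rule: below.induct) (auto intro: below.intros)

lemma below_chain: "x \<in> below N U x0 \<Longrightarrow> j \<in> U \<Longrightarrow> chain N j r x \<in> below N U x0"
  by (induction r) (auto intro: below.intros)

lemma below_layer: "x \<in> below N U x0 \<Longrightarrow> fst x0 \<le> fst x"
  by (induction rule: below.induct) auto

lemma below_mod:
  assumes "x \<in> below N U x0" "\<And>j. j \<in> U \<Longrightarrow> 2 * int j + 1 < N" "fst x0 < fst x"
  shows "\<exists>j\<in>U. snd x mod N = 2 * int j + 1"
  using assms by (cases rule: below.cases) (auto simp: step_mod)

lemma below_reg:
  assumes "x \<in> below N U x0" "\<And>j. j \<in> U \<Longrightarrow> 2 * int j + 1 < N"
  shows "reg N (fst x) (snd x) s \<in> below N U x0 \<or> fst (reg N (fst x) (snd x) s) \<le> fst x0"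
  using assms
proof (induction rule: below.induct)
  case start then show ?case by (simp add: reg_layer)
next
  case (step x j)
  then show ?case
    using reg_step[of j N x s] below.step[OF step.hyps] by (simp del: fst_step reg.simps)
qed

text \<open>Register contents are nodes passed on the way from \<open>x0\<close> or inherited from
  \<open>x0\<close>; the latter lie no later than the layer of \<open>x0\<close>.\<close>

lemma below_ups:
  assumes "x \<in> below N U x0" "\<And>j. j \<in> U \<Longrightarrow> 2 * int j + 1 < N" "y \<in> ups N x" "fst x0 < fst y"
  shows "y \<in> below N U x0"
  using assms(1)
proof (cases rule: below.cases)
  case start
  then show ?thesis using assms(3,4) ups_layer by fastforce
next
  case (step x' j)
  then show ?thesis using ups_step[OF assms(2), of j x'] below_reg[OF step(2) assms(2)] assms(3,4) by fastforce
qed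

lemma below_horizontal:
  assumes "x \<in> below N U x0" "y \<in> below N U x0" "\<And>j. j \<in> U \<Longrightarrow> 2 * int j + 1 < N"
    and "odd N" "fst x0 < fst x" "fst x0 < fst y"
  shows "\<bar>snd x - snd y\<bar> \<noteq> 1"
proof
  assume a: "\<bar>snd x - snd y\<bar> = 1"
  obtain i j where ij: "i \<in> U" "j \<in> U" "snd x mod N = 2 * int i + 1" "snd y mod N = 2 * int j + 1"
    using below_mod assms by metis
  have *: False if "b = a + 1" "a mod N = 2 * int i + 1" "b mod N = 2 * int j + 1" "i \<in> U" for a b i j
  proof -
    \<comment> \<open>An odd index below the odd number \<open>N\<close> is at most
      \<open>N - 2\<close>, so the next node is a sibling, of even index.\<close>
    have "2 * int i + 1 + 1 < N" using assms(3)[OF that(4)] \<open>odd N\<close> by presburger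
    then have "(2 * int i + 1 + 1) mod N = 2 * int i + 2" by simp
    moreover have "b mod N = (2 * int i + 1 + 1) mod N" using that by (metis mod_add_left_eq)
    ultimately have "2 * int j + 1 = 2 * int i + 2" using that(3) by simp
    then show False by presburger
  qed
  consider "snd x = snd y + 1" | "snd y = snd x + 1" using a by linarith
  then show False using *[OF _ ij(4,3,2)] *[OF _ ij(3,4,1)] by cases blast+
qed

text \<open>
  Each embedded vertex uses a type \<open>j\<close> not used before. Hence it is not an ancestor of any earlier one,
  and its only earlier neighbours are those prescribed by \<open>sel j\<close>.
\<close>

lemma built_embeds:
  assumes "built t E V Bs" and E: "\<And>e. e \<in> E \<Longrightarrow> card e = 2"
    and J: "\<And>j. j \<in> J \<Longrightarrow> 2 * int j + 1 < N" "finite J" and N: "odd N"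
    and Jrich: "\<And>s \<alpha>. s \<le> t \<Longrightarrow> \<alpha> \<subseteq> {..t} \<Longrightarrow> q \<le> card {j \<in> J. slot j = s \<and> sel j = \<alpha>}"
    and "card V \<le> q" "good N J X (e + card V) x0"
  shows "\<exists>U \<phi>. U \<subseteq> J \<and> card U \<le> card V \<and> inj_on \<phi> V \<and> \<phi> ` V \<subseteq> X \<inter> below N U x0 \<and>
    (\<forall>u\<in>V. fst x0 < fst (\<phi> u)) \<and> (\<forall>u\<in>V. \<forall>w\<in>V. adj N (\<phi> u) (\<phi> w) \<longleftrightarrow> {u, w} \<in> E) \<and>
    (\<forall>b\<in>Bs. \<exists>x\<in>below N U x0. good N J X e x \<and> \<phi> ` b \<subseteq> regs N (fst x) (snd x))"
  using assms(1,7,8)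
proof (induction arbitrary: e rule: built.induct)
  case empty
  then show ?case by (intro exI[of _ "{}"]) (auto intro: below.start)
next
  case (insert V Bs b \<beta> h)
  have fV: "finite V" and bV: "b \<subseteq> V" using built_finite insert.hyps by blast+
  have cV: "card (Set.insert h V) = Suc (card V)" using fV insert.hyps by simp
  \<comment> \<open>One extra round of \<open>good\<close> is reserved for the new vertex.\<close>
  have "good N J X (Suc e + card V) x0" using insert.prems cV by simp
  then obtain U \<phi> where U: "U \<subseteq> J" "card U \<le> card V" and inj: "inj_on \<phi> V"
    and img: "\<phi> ` V \<subseteq> X \<inter> below N U x0" and lay: "\<And>u. u \<in> V \<Longrightarrow> fst x0 < fst (\<phi> u)"
    and ad: "\<And>u w. u \<in> V \<Longrightarrow> w \<in> V \<Longrightarrow> adj N (\<phi> u) (\<phi> w) \<longleftrightarrow> {u, w} \<in> E"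
    and bags: "\<And>b. b \<in> Bs \<Longrightarrow> \<exists>x\<in>below N U x0. good N J X (Suc e) x \<and> \<phi> ` b \<subseteq> regs N (fst x) (snd x)"
    using insert.IH[of "Suc e"] insert.prems cV by (metis Suc_leD)
  obtain x where x: "x \<in> below N U x0" "good N J X (Suc e) x" "\<phi> ` b \<subseteq> regs N (fst x) (snd x)"
    using bags insert.hyps by blast
  have "\<exists>s\<le>t. \<phi> u = reg N (fst x) (snd x) s" if "u \<in> \<beta>" for u
  proof -
    have "\<phi> u \<in> regs N (fst x) (snd x)" using that insert.hyps x by blast
    then show ?thesis by (auto simp: regs_def)
  qed
  then obtain \<sigma> where \<sigma>: "\<And>u. u \<in> \<beta> \<Longrightarrow> \<sigma> u \<le> t \<and> \<phi> u = reg N (fst x) (snd x) (\<sigma> u)" by metis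
  have f\<beta>: "finite \<beta>" "\<beta> \<subseteq> V" using fV bV insert.hyps by (meson finite_subset order_trans)+
  \<comment> \<open>The vertices of \<beta> occupy at most \<open>t\<close> of the
    \<open>t + 1\<close> registers, so some register \<open>s\<close> is free for the new
    vertex.\<close>
  have "card (\<sigma> ` \<beta>) \<le> t" using card_image_le[OF f\<beta>(1), of \<sigma>] insert.hyps by linarith
  then have "\<sigma> ` \<beta> \<noteq> {..t}" by auto
  moreover have "\<sigma> ` \<beta> \<subseteq> {..t}" using \<sigma> by auto
  ultimately obtain s where s: "s \<le> t" "s \<notin> \<sigma> ` \<beta>" by blast
  \<comment> \<open>Only registers of actual neighbours are selected; the rest of \<beta> stays
    stored without an edge.\<close>
  define \<alpha> where "\<alpha> = \<sigma> ` {u \<in> \<beta>. {h, u} \<in> E}"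
  have \<alpha>: "\<alpha> \<subseteq> {..t}" "s \<notin> \<alpha>" using \<sigma> s by (auto simp: \<alpha>_def)
  \<comment> \<open>Fewer than \<open>q\<close> types have been used, so one of the required kind is
    fresh.\<close>
  have "card U < card {j \<in> J. slot j = s \<and> sel j = \<alpha>}"
    using Jrich[OF s(1) \<alpha>(1)] U insert.prems cV by linarith
  then have "\<not> {j \<in> J. slot j = s \<and> sel j = \<alpha>} \<subseteq> U"
    using card_mono[of U] U J(2) by (meson finite_subset linorder_not_less)
  then obtain j where j: "j \<in> J" "slot j = s" "sel j = \<alpha>" "j \<notin> U" by blast
  have jN: "2 * int j + 1 < N" using J j by blast
  obtain r where r: "chain N j (Suc r) x \<in> X" "good N J X e (chain N j (Suc r) x)"
    using x(2) j(1) by auto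
  define y where "y = chain N j (Suc r) x"
  let ?U = "Set.insert j U" and ?\<phi> = "\<phi>(h := y)"
  have UN: "\<And>j. j \<in> U \<Longrightarrow> 2 * int j + 1 < N" "\<And>j. j \<in> ?U \<Longrightarrow> 2 * int j + 1 < N"
    using U J j by auto
  have bm: "z \<in> below N ?U x0" if "z \<in> below N U x0" for z using below_mono[OF _ that] by blast
  have yb: "y \<in> below N ?U x0" unfolding y_def using x(1) bm by (intro below_chain) auto
  have yl: "fst x0 < fst y" using below_layer[OF x(1)] by (simp add: y_def)
  have ynb: "y \<notin> below N U x0"
  proof
    assume "y \<in> below N U x0"
    then obtain j' where "j' \<in> U" "snd y mod N = 2 * int j' + 1" using below_mod[OF _ UN(1) yl] by blast
    moreover have "snd y mod N = 2 * int j + 1" unfolding y_def using step_mod[OF jN] by simp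
    ultimately show False using j by simp
  qed
  have hV: "h \<notin> V" using insert.hyps by blast
  have yups: "ups N y = \<phi> ` {u \<in> V. {h, u} \<in> E}"
  proof -
    have "ups N y = reg N (fst x) (snd x) ` \<alpha>"
      unfolding y_def using ups_chain[OF jN] j \<alpha> by simp
    also have "\<dots> = \<phi> ` {u \<in> \<beta>. {h, u} \<in> E}" unfolding \<alpha>_def image_image using \<sigma> by (intro image_cong) auto
    also have "{u \<in> \<beta>. {h, u} \<in> E} = {u \<in> V. {h, u} \<in> E}" using insert.hyps f\<beta> by blast
    finally show ?thesis .
  qed
  have ady: "adj N y (\<phi> u) \<longleftrightarrow> {h, u} \<in> E" if u: "u \<in> V" for u
  proof -
    have ub: "\<phi> u \<in> below N U x0" using u img by blast
    \<comment> \<open>Otherwise \<open>y\<close> would be reachable by the types in \<open>U\<close>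
      alone.\<close>
    have "y \<notin> ups N (\<phi> u)" using below_ups[OF ub UN(1) _ yl] ynb by blast
    moreover have "\<bar>snd y - snd (\<phi> u)\<bar> \<noteq> 1"
      by (rule below_horizontal[OF yb bm[OF ub] UN(2) N yl lay[OF u]])
    moreover have "\<phi> u \<in> ups N y \<longleftrightarrow> {h, u} \<in> E"
      unfolding yups using u inj by (auto simp: inj_on_def)
    ultimately show ?thesis by (auto simp: adj_def)
  qed
  have noloop: "{h, h} \<notin> E" using E[of "{h, h}"] by auto
  have ynot: "y \<notin> \<phi> ` V" using ynb img by blast
  have "?U \<subseteq> J" using U j by blast
  moreover have "card ?U \<le> card (Set.insert h V)"
    using U j cV card_insert_le_m1[of "Suc (card V)" U j] by simp
  moreover have "inj_on ?\<phi> (Set.insert h V)"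
    using inj ynot hV by (auto simp: inj_on_def)
  moreover have "?\<phi> ` (Set.insert h V) \<subseteq> X \<inter> below N ?U x0"
    using img bm yb r(1)[folded y_def] by (simp add: image_subset_iff)
  moreover have "\<forall>u\<in>Set.insert h V. fst x0 < fst (?\<phi> u)" using lay yl by auto
  moreover have "\<forall>u\<in>Set.insert h V. \<forall>w\<in>Set.insert h V. adj N (?\<phi> u) (?\<phi> w) \<longleftrightarrow> {u, w} \<in> E"
  proof (intro ballI)
    fix u w assume uw: "u \<in> Set.insert h V" "w \<in> Set.insert h V"
    consider "u = h" "w = h" | "u = h" "w \<in> V" "w \<noteq> h" | "u \<in> V" "u \<noteq> h" "w = h" | "u \<in> V" "w \<in> V" "u \<noteq> h" "w \<noteq> h"
      using uw hV by blast
    then show "adj N (?\<phi> u) (?\<phi> w) \<longleftrightarrow> {u, w} \<in> E"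
    proof cases
      case 1 then show ?thesis using noloop adj_irrefl by simp
    next
      case 2 then show ?thesis using ady by simp
    next
      case 3 then show ?thesis using ady[of u] adj_sym[of N "\<phi> u" y] by (simp add: insert_commute)
    next
      case 4 then show ?thesis using ad by simp
    qed
  qed
  moreover have "\<forall>b\<in>Set.insert (Set.insert h \<beta>) Bs. \<exists>x\<in>below N ?U x0. good N J X e x \<and>
      ?\<phi> ` b \<subseteq> regs N (fst x) (snd x)"
  proof
    fix b' assume "b' \<in> Set.insert (Set.insert h \<beta>) Bs"
    then consider "b' = Set.insert h \<beta>" | "b' \<in> Bs" by blast
    then show "\<exists>x\<in>below N ?U x0. good N J X e x \<and> ?\<phi> ` b' \<subseteq> regs N (fst x) (snd x)"
    proof cases
      case 1
      have "\<phi> u \<in> regs N (fst y) (snd y)" if "u \<in> \<beta>" for u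
      proof -
        \<comment> \<open>The chain overwrites only the free register, so \<beta> is still stored at
          \<open>y\<close>.\<close>
        have "\<sigma> u \<noteq> slot j" using that s(2) j(2) by (metis imageI)
        then have "\<phi> u = reg N (fst y) (snd y) (\<sigma> u)"
          using \<sigma>[OF that] reg_chain[OF jN] unfolding y_def by metis
        then show ?thesis using \<sigma>[OF that] unfolding regs_def by blast
      qed
      moreover have "y \<in> regs N (fst y) (snd y)" using self_in_regs[of "fst y" "snd y"] by simp
      moreover have "h \<notin> \<beta>" using f\<beta> hV by blast
      ultimately have "?\<phi> ` b' \<subseteq> regs N (fst y) (snd y)" using 1 by auto
      then show ?thesis using yb r(2) unfolding y_def by blast
    next
      case 2
      then have "h \<notin> b'" using built_finite[OF insert.hyps(1)] hV by blast
      then have "?\<phi> ` b' = \<phi> ` b'" by auto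
      then show ?thesis using bags[OF 2] bm good_Suc_imp_good by metis
    qed
  qed
  ultimately show ?case by blast
qed

section \<open>The class of wheels\<close>

definition wheel :: "int \<Rightarrow> (nat \<times> int) set \<Rightarrow> graph" where
  "wheel N X = \<lparr>verts = to_nat ` X, edges = {{to_nat x, to_nat y} | x y. x \<in> X \<and> y \<in> X \<and> adj N x y}\<rparr>"

lemma verts_wheel [simp]: "verts (wheel N X) = to_nat ` X"
  by (simp add: wheel_def)

lemma edges_wheelE:
  assumes "e \<in> edges (wheel N X)"
  obtains x y where "e = {to_nat x, to_nat y}" "x \<in> X" "y \<in> X" "adj N x y"
  using assms unfolding wheel_def graph.simps mem_Collect_eq by blast

lemma edges_wheel [simp]:
  "{to_nat x, to_nat y} \<in> edges (wheel N X) \<longleftrightarrow> x \<in> X \<and> y \<in> X \<and> adj N x y"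
proof
  assume "{to_nat x, to_nat y} \<in> edges (wheel N X)"
  then obtain x' y' where "{to_nat x, to_nat y} = {to_nat x', to_nat y'}" "x' \<in> X" "y' \<in> X" "adj N x' y'"
    by (rule edges_wheelE)
  then show "x \<in> X \<and> y \<in> X \<and> adj N x y" using adj_sym[of N x' y'] by (auto simp: doubleton_eq_iff)
next
  assume "x \<in> X \<and> y \<in> X \<and> adj N x y"
  then show "{to_nat x, to_nat y} \<in> edges (wheel N X)"
    unfolding wheel_def graph.simps mem_Collect_eq by blast
qed

lemma wf_wheel: "finite X \<Longrightarrow> wf_graph (wheel N X)"
  using adj_irrefl by (auto simp: wf_graph_def wheel_def card_insert_if)

lemma induced_wheel: "induced (wheel N X) S = wheel N {x \<in> X. to_nat x \<in> S}"
  by (auto simp: induced_def wheel_def simp del: split_paired_Ex)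

lemma rooted_decomp_wheel:
  assumes "rooted_decomp (adj N) k X R"
  shows "tw_le (wheel N X) k"
proof -
  obtain bs where bs: "rip bs" "\<Union>(set bs) = X" "\<forall>b\<in>set bs. card b \<le> k"
    "\<forall>x\<in>X. \<forall>y\<in>X. adj N x y \<longrightarrow> (\<exists>b\<in>set bs. x \<in> b \<and> y \<in> b)"
    using assms unfolding rooted_decomp_def by blast
  show ?thesis
  proof (rule rip_imp_tw_le[of "map ((`) to_nat) bs"])
    show "rip (map ((`) to_nat) bs)" by (rule rip_map[OF bs(1)]) simp
    show "\<Union>(set (map ((`) to_nat) bs)) = verts (wheel N X)" using bs(2) by auto
    show "card b \<le> k + 1" if "b \<in> set (map ((`) to_nat) bs)" for b
      using that bs(3) by (auto simp: card_image le_SucI)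
    show "\<exists>b\<in>set (map ((`) to_nat) bs). e \<subseteq> b" if e: "e \<in> edges (wheel N X)" for e
    proof -
      obtain x y where xy: "e = {to_nat x, to_nat y}" "x \<in> X" "y \<in> X" "adj N x y"
        using e by (rule edges_wheelE)
      then obtain b where "b \<in> set bs" "x \<in> b" "y \<in> b" using bs(4) by blast
      then show ?thesis using xy by auto
    qed
  qed
qed

text \<open>\<open>built_embeds\<close> with \<open>e = 0\<close>: each vertex of \<open>H\<close>
  costs one round of \<open>good\<close> and one fresh type.\<close>

lemma good_imp_not_H_free:
  assumes H: "wf_graph H" "tw_le H t"
    and J: "\<And>j. j \<in> J \<Longrightarrow> 2 * int j + 1 < N" "finite J" and N: "odd N"
    and Jrich: "\<And>s \<alpha>. s \<le> t \<Longrightarrow> \<alpha> \<subseteq> {..t} \<Longrightarrow>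
      card (verts H) \<le> card {j \<in> J. slot j = s \<and> sel j = \<alpha>}"
    and "good N J X (card (verts H)) x0"
  shows "\<not> H_free H (wheel N X)"
proof -
  obtain Bs where Bs: "built t (edges H) (verts H) Bs" using tw_le_imp_built H by blast
  have E: "card e = 2" if "e \<in> edges H" for e using H that by (auto simp: wf_graph_def)
  obtain \<phi> where \<phi>: "inj_on \<phi> (verts H)" "\<phi> ` verts H \<subseteq> X"
    "\<And>u w. u \<in> verts H \<Longrightarrow> w \<in> verts H \<Longrightarrow> adj N (\<phi> u) (\<phi> w) \<longleftrightarrow> {u, w} \<in> edges H"
    using built_embeds[OF Bs E J N Jrich order_refl, of X 0 x0] assms(7) by auto
  let ?S = "to_nat ` \<phi> ` verts H"
  have "bij_betw (\<lambda>u. to_nat (\<phi> u)) (verts H) (verts (induced (wheel N X) ?S))"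
    using \<phi>(1,2) by (auto simp: bij_betw_def inj_on_def induced_def)
  moreover have "{u, w} \<in> edges H \<longleftrightarrow> {to_nat (\<phi> u), to_nat (\<phi> w)} \<in> edges (induced (wheel N X) ?S)"
    if "u \<in> verts H" "w \<in> verts H" for u w
  proof -
    have "\<phi> u \<in> X" "\<phi> w \<in> X" using that \<phi>(2) by auto
    then show ?thesis using that \<phi>(3)[OF that] unfolding induced_wheel by simp
  qed
  ultimately have "graph_iso H (induced (wheel N X) ?S)" unfolding graph_iso_def by blast
  moreover have "?S \<subseteq> verts (wheel N X)" using \<phi>(2) by auto
  ultimately show ?thesis unfolding H_free_def by blast
qed

text \<open>One parameter \<open>n\<close> bounds the layers and fixes the number of children.
  Hence, for a given finite set of types, either all are available or the number of layers is
  bounded.\<close>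

definition wheels :: "graph set" where
  "wheels = {wheel (2 * int n + 1) X | n X. finite X \<and> X \<subseteq> {..n} \<times> UNIV}"

lemma wf_wheels: "G \<in> wheels \<Longrightarrow> wf_graph G"
  by (auto simp: wheels_def wf_wheel)

lemma hereditary_wheels: "hereditary wheels"
  unfolding hereditary_def
proof (intro ballI allI)
  fix G S assume "G \<in> wheels"
  then obtain n X where X: "G = wheel (2 * int n + 1) X" "finite X" "X \<subseteq> {..n} \<times> UNIV"
    by (auto simp: wheels_def)
  then have "finite {x \<in> X. to_nat x \<in> S}" "{x \<in> X. to_nat x \<in> S} \<subseteq> {..n} \<times> UNIV" by auto
  then show "induced G S \<in> wheels" unfolding X(1) induced_wheel wheels_def by blast
qed

section \<open>Weak sparsity\<close>

text \<open>At most \<open>t + 1\<close> neighbours come from the registers of the parent and two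
  from the same layer.\<close>

lemma card_upper_neighbours:
  assumes "B \<subseteq> {y. adj N x y \<and> fst y \<le> fst x}"
  shows "card B \<le> t + 3"
proof -
  obtain m v where x: "x = (m, v)" by fastforce
  let ?A = "ups N x \<union> {(m, v - 1), (m, v + 1)}"
  have u: "finite (ups N x) \<and> card (ups N x) \<le> t + 1"
  proof (cases m)
    case (Suc m')
    then have s: "ups N x \<subseteq> regs N m' (v div N)" using x ups_subset_regs by simp
    then show ?thesis
      using finite_regs card_regs[of N m' "v div N"] card_mono[OF finite_regs s]
      by (meson finite_subset order_trans)
  qed (simp add: x)
  have "B \<subseteq> ?A"
  proof
    fix y assume y: "y \<in> B"
    obtain i w where iw: "y = (i, w)" by fastforce
    have a: "adj N x y" "i \<le> m" using y assms iw x by auto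
    show "y \<in> ?A"
    proof (cases "y \<in> ups N x")
      case False
      have "x \<notin> ups N y" using ups_layer[of x N y] a iw x by auto
      then have "i = m" "\<bar>v - w\<bar> = 1" using False a iw x by (auto simp: adj_def)
      then have "w = v - 1 \<or> w = v + 1" by linarith
      then show ?thesis using iw \<open>i = m\<close> by auto
    qed simp
  qed
  then have "card B \<le> card ?A" using u by (intro card_mono) auto
  also have "\<dots> \<le> card (ups N x) + card {(m, v - 1), (m, v + 1)}" by (rule card_Un_le)
  also have "\<dots> \<le> (t + 1) + 2" using u by (intro add_mono) auto
  finally show ?thesis by simp
qed

text \<open>For a vertex of maximal layer in a complete bipartite subgraph, the whole other side
  lies in its own and earlier layers, so that side has at most \<open>t + 3\<close>
  vertices.\<close>

lemma weakly_sparse_wheels: "weakly_sparse wheels"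
  unfolding weakly_sparse_def
proof (intro exI ballI notI)
  fix G assume "G \<in> wheels" "contains_Kss (t + 4) G"
  then obtain n X A B where X: "G = wheel (2 * int n + 1) X" "finite X"
    and AB: "A \<subseteq> verts G" "B \<subseteq> verts G" "card A = t + 4" "card B = t + 4"
      "\<forall>a\<in>A. \<forall>b\<in>B. {a, b} \<in> edges G"
    unfolding wheels_def contains_Kss_def by blast
  let ?N = "2 * int n + 1"
  let ?f = "\<lambda>a. fst (from_nat a :: nat \<times> int)"
  have False if cd: "C \<subseteq> verts G" "D \<subseteq> verts G" "\<forall>a\<in>C. \<forall>b\<in>D. {a, b} \<in> edges G" "card D = t + 4"
    and c: "c \<in> C" and mx: "\<forall>d\<in>D. ?f d \<le> ?f c" for C D c
  proof -
    have "c \<in> to_nat ` X" using cd(1) c X(1) by auto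
    then obtain x :: "nat \<times> int" where x: "c = to_nat x" by blast
    let ?D = "from_nat ` D :: (nat \<times> int) set"
    have tf: "to_nat (from_nat d :: nat \<times> int) = d" if "d \<in> D" for d
      using that cd(2) X by auto
    then have "inj_on (from_nat :: nat \<Rightarrow> nat \<times> int) D" by (metis inj_onI)
    then have "card ?D = t + 4" using cd(4) by (simp add: card_image)
    moreover have "?D \<subseteq> {y. adj ?N x y \<and> fst y \<le> fst x}"
    proof
      fix y assume "y \<in> ?D"
      then obtain d where d: "d \<in> D" "y = from_nat d" by blast
      then have "{to_nat x, to_nat y} \<in> edges G" using cd(3) c x tf by simp
      then show "y \<in> {y. adj ?N x y \<and> fst y \<le> fst x}" using mx d x X by simp
    qed
    ultimately show False using card_upper_neighbours[of ?D ?N x] by simp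
  qed note * = this
  have fin: "finite (A \<union> B)" "A \<union> B \<noteq> {}" using AB(3,4) by (auto intro: card_ge_0_finite)
  define M where "M = Max (?f ` (A \<union> B))"
  have "M \<in> ?f ` (A \<union> B)" unfolding M_def using fin by (intro Max_in) auto
  then obtain c where c: "c \<in> A \<union> B" "M = ?f c" by blast
  have mx: "?f d \<le> ?f c" if "d \<in> A \<union> B" for d
    unfolding c(2)[symmetric] M_def using fin that by (intro Max_ge) auto
  show False
  proof (cases "c \<in> A")
    case True then show ?thesis using *[of A B c] AB mx by blast
  next
    case False
    have "\<forall>b\<in>B. \<forall>a\<in>A. {b, a} \<in> edges G" using AB(5) by (metis insert_commute)
    then show ?thesis using *[of B A c] AB mx False c by blast
  qed
qed

section \<open>Bounded treewidth of the H-free members\<close>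

lemma finite_rich_types:
  "\<exists>J. finite J \<and> (\<forall>s\<le>t. \<forall>\<alpha>\<subseteq>{..t}. q \<le> card {j \<in> J. slot j = s \<and> sel j = \<alpha>})"
proof -
  have "\<forall>p\<in>{..t} \<times> Pow {..t}. \<exists>F. finite F \<and> card F = q \<and> F \<subseteq> {j. slot j = fst p \<and> sel j = snd p}"
  proof
    fix p assume "p \<in> {..t} \<times> Pow {..t}"
    then have "infinite {j. slot j = fst p \<and> sel j = snd p}" by (intro rich) auto
    then show "\<exists>F. finite F \<and> card F = q \<and> F \<subseteq> {j. slot j = fst p \<and> sel j = snd p}"
      using infinite_arbitrarily_large[of "{j. slot j = fst p \<and> sel j = snd p}" q] by blast
  qed
  then obtain F where F: "\<And>p. p \<in> {..t} \<times> Pow {..t} \<Longrightarrow>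
      finite (F p) \<and> card (F p) = q \<and> F p \<subseteq> {j. slot j = fst p \<and> sel j = snd p}"
    by metis
  let ?J = "\<Union>(F ` ({..t} \<times> Pow {..t}))"
  have fin: "finite ?J" using F by auto
  have "q \<le> card {j \<in> ?J. slot j = s \<and> sel j = \<alpha>}" if "s \<le> t" "\<alpha> \<subseteq> {..t}" for s \<alpha>
  proof -
    have p: "(s, \<alpha>) \<in> {..t} \<times> Pow {..t}" using that by auto
    have "F (s, \<alpha>) \<subseteq> {j \<in> ?J. slot j = s \<and> sel j = \<alpha>}" using F[OF p] p by auto
    then have "card (F (s, \<alpha>)) \<le> card {j \<in> ?J. slot j = s \<and> sel j = \<alpha>}"
      using fin by (intro card_mono) auto
    then show ?thesis using F[OF p] by simp
  qed
  then show ?thesis using fin by blast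
qed

lemma H_free_wheels_bounded:
  assumes H: "wf_graph H" "tw_le H t"
  shows "bounded_tw {G \<in> wheels. H_free H G}"
proof -
  let ?q = "card (verts H)"
  obtain J where J: "finite J" "\<And>s \<alpha>. s \<le> t \<Longrightarrow> \<alpha> \<subseteq> {..t} \<Longrightarrow> ?q \<le> card {j \<in> J. slot j = s \<and> sel j = \<alpha>}"
    using finite_rich_types by meson
  obtain K where K: "\<And>j. j \<in> J \<Longrightarrow> j < K" using J(1) by (meson finite_nat_set_iff_bounded)
  \<comment> \<open>\<open>?q\<close> bounds the paths when \<open>K \<le> n\<close>, so that all
    types in \<open>J\<close> are available; \<open>K\<close> handles \<open>n < K\<close>, where a
    path meets \<open>X\<close> at most \<open>n + 1\<close> times.\<close>
  define D where "D = ?q + K + 1"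
  have "tw_le G (2 * (t + 1) + 4 * D)" if G: "G \<in> wheels" "H_free H G" for G
  proof -
    obtain n X where X: "G = wheel (2 * int n + 1) X" "finite X" "X \<subseteq> {..n} \<times> UNIV"
      using G by (auto simp: wheels_def)
    define N where "N = 2 * int n + 1"
    have N: "0 < N" "odd N" by (auto simp: N_def)
    have "\<exists>P. descending N m P \<and> P m = c \<and> card (X \<inter> trail m P) \<le> D" for m c
    proof (cases "K \<le> n")
      case True
      have JN: "2 * int j + 1 < N" if "j \<in> J" for j using K[OF that] True by (simp add: N_def)
      have "\<not> good N J X ?q (m, c)"
        using good_imp_not_H_free[OF H JN J(1) N(2) J(2)] G X N_def by blast
      then obtain P where P: "descending N m P" "P m = c" "card (X \<inter> trail (Suc m) P) < ?q"
        using not_good_imp_path[OF JN X(2)] by blast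
      have "X \<inter> trail m P \<subseteq> insert (m, c) (X \<inter> trail (Suc m) P)"
        using P(2) by (force simp: trail_def Suc_le_eq order_le_less)
      then have "card (X \<inter> trail m P) \<le> card (insert (m, c) (X \<inter> trail (Suc m) P))"
        using X(2) by (intro card_mono) auto
      also have "\<dots> \<le> Suc (card (X \<inter> trail (Suc m) P))" by (rule card_insert_le_m1) simp_all
      finally show ?thesis using P by (auto simp: D_def)
    next
      case False
      \<comment> \<open>With few layers any path will do; this one always takes the child of index
        0.\<close>
      define P where "P i = c * N ^ (i - m)" for i
      have "descending N m P" using N by (auto simp: descending_def P_def Suc_diff_le)
      moreover have "X \<inter> trail m P \<subseteq> (\<lambda>i. (i, P i)) ` {..n}" using X(3) by (auto simp: trail_def)
      then have "card (X \<inter> trail m P) \<le> card ((\<lambda>i. (i, P i)) ` {..n})" by (intro card_mono) auto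
      then have "card (X \<inter> trail m P) \<le> Suc n" using card_image_le[of "{..n}" "\<lambda>i. (i, P i)"] by simp
      ultimately show ?thesis using False by (intro exI[of _ P]) (auto simp: D_def P_def)
    qed
    then obtain R where "rooted_decomp (adj N) (2 * (t + 1) + 4 * D) X R"
      using decomp_of_paths[OF N(1) X(2,3)] by blast
    then show ?thesis using rooted_decomp_wheel X N_def by blast
  qed
  then show ?thesis unfolding bounded_tw_def by blast
qed

section \<open>Unbounded treewidth\<close>

lemma int_interval_cut:
  fixes M :: int
  assumes "T \<subseteq> {0..<M}" "T \<noteq> {}" "T \<noteq> {0..<M}"
  shows "\<exists>v. 0 \<le> v \<and> v + 1 < M \<and> (v \<in> T) \<noteq> (v + 1 \<in> T)"
proof (rule ccontr)
  assume a: "\<not> ?thesis"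
  have "v < M \<longrightarrow> (v \<in> T \<longleftrightarrow> 0 \<in> T)" if "0 \<le> v" for v
    using that a by (induction rule: int_ge_induct) auto
  then show False using assms by (cases "0 \<in> T") force+
qed

text \<open>In layer \<open>i\<close> the descendants of \<open>(0, 0)\<close> occupy the positions
  from 0 to \<open>N ^ i - 1\<close>, and chains stay among descendants.\<close>

lemma chain_bounds:
  assumes "2 * int j + 1 < N" "0 \<le> snd x" "snd x < N ^ fst x"
  shows "0 \<le> snd (chain N j r x) \<and> snd (chain N j r x) < N ^ fst (chain N j r x)"
proof (induction r)
  case (Suc r)
  let ?y = "chain N j r x"
  have "(snd ?y + 1) * N \<le> N ^ fst ?y * N" using Suc assms(1) by (intro mult_right_mono) auto
  moreover have "0 \<le> snd ?y * N" using Suc assms(1) by auto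
  moreover have "snd (chain N j (Suc r) x) = snd ?y * N + (2 * int j + 1)"
    "N ^ fst (chain N j (Suc r) x) = N ^ fst ?y * N"
    by (simp_all add: step_def)
  moreover have "(snd ?y + 1) * N = snd ?y * N + N" by (simp add: distrib_right)
  ultimately show ?case using assms(1) by linarith
qed (use assms in auto)

text \<open>
  Layers \<open>i < j\<close> are adjacent: a node of layer \<open>i\<close> stored in register 0 is kept there, and joined to, by
  all nodes of a chain that overwrites register 1. This needs \<open>t \<ge> 1\<close>.
\<close>

lemma unbounded_wheels:
  assumes t: "1 \<le> t"
  shows "\<not> bounded_tw wheels"
proof
  assume "bounded_tw wheels"
  then obtain k where k: "\<And>G. G \<in> wheels \<Longrightarrow> tw_le G k" by (auto simp: bounded_tw_def)
  have "{j. slot j = 0 \<and> sel j = {}} \<noteq> {}" "{j. slot j = 1 \<and> sel j = {0}} \<noteq> {}"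
    using rich[of 0 "{}"] rich[of 1 "{0}"] t by (auto dest: infinite_imp_nonempty)
  then obtain j0 j1 where j0: "slot j0 = 0" and j1: "slot j1 = 1" "sel j1 = {0}" by blast
  \<comment> \<open>Large enough for both types to occur and for more than \<open>k + 1\<close>
    layers.\<close>
  define n where "n = k + 2 + j0 + j1"
  define N where "N = 2 * int n + 1"
  have jN: "2 * int j0 + 1 < N" "2 * int j1 + 1 < N" and N: "0 < N" "1 \<le> N" by (auto simp: N_def n_def)
  define L where "L i = {i} \<times> {0..<N ^ i}" for i :: nat
  \<comment> \<open>Layer 0 is left out: its only node \<open>(0, 0)\<close> leaves no room for the
    position \<open>2 * int j0 + 1\<close>.\<close>
  define X where "X = (\<Union>i\<in>{1..n}. L i)"
  have X: "finite X" "X \<subseteq> {..n} \<times> UNIV" by (auto simp: X_def L_def)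
  then have "wheel N X \<in> wheels" unfolding wheels_def N_def by blast
  then obtain bs where bs: "rip bs" "\<Union>(set bs) = to_nat ` X" "\<And>b. b \<in> set bs \<Longrightarrow> card b \<le> k + 1"
    "\<And>e. e \<in> edges (wheel N X) \<Longrightarrow> \<exists>b\<in>set bs. e \<subseteq> b"
    using tw_le_imp_rip[OF k wf_wheel[OF X(1)]] by (metis verts_wheel)
  have bag: "\<exists>b\<in>set bs. to_nat x \<in> b \<and> to_nat y \<in> b" if "x \<in> X" "y \<in> X" "adj N x y" for x y
  proof -
    have "{to_nat x, to_nat y} \<in> edges (wheel N X)" using that by simp
    then show ?thesis using bs(4)[of "{to_nat x, to_nat y}"] by simp
  qed
  have LX: "L i \<subseteq> X" if "i \<in> {1..n}" for i using that by (auto simp: X_def)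
  let ?B = "\<lambda>i. to_nat ` L i"
  have touch: "\<exists>b\<in>set bs. b \<inter> ?B i \<noteq> {} \<and> b \<inter> ?B j \<noteq> {}" if ij: "i \<in> {1..n}" "j \<in> {1..n}" "i < j" for i j
  proof -
    obtain i' where i': "i = Suc i'" using ij by (cases i) auto
    define x where "x = (i, 2 * int j0 + 1)"
    have "N \<le> N ^ i" using N i' by (simp add: self_le_power)
    then have xb: "0 \<le> snd x" "snd x < N ^ fst x" using jN by (auto simp: x_def)
    obtain r where r: "j = i + Suc r" using ij(3) less_iff_Suc_add by auto
    define y where "y = chain N j1 (Suc r) x"
    have "0 \<le> snd y \<and> snd y < N ^ fst y" unfolding y_def by (rule chain_bounds[OF jN(2) xb])
    moreover have "fst y = j" by (simp add: y_def x_def r)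
    ultimately have yL: "y \<in> L j" by (auto simp: L_def mem_Times_iff)
    have xL: "x \<in> L i" using xb by (auto simp: L_def x_def)
    have "tp N (2 * int j0 + 1) = j0" using jN(1) by (simp add: tp_def nat_add_distrib nat_mult_distrib)
    then have "reg N (fst x) (snd x) 0 = x" using j0 by (simp add: x_def i')
    then have "x \<in> ups N y" unfolding y_def using ups_chain[OF jN(2), of r x] j1 by simp
    then have "adj N x y" by (simp add: adj_def)
    then show ?thesis using bag[of x y] xL yL LX ij by blast
  qed
  \<comment> \<open>The layers are connected and touch pairwise, so one bag meets all
    \<open>n\<close> of them; as they are disjoint, it has more than \<open>k + 1\<close>
    elements.\<close>
  have "\<exists>b\<in>set bs. \<forall>i\<in>{1..n}. b \<inter> ?B i \<noteq> {}"
  proof (rule rip_helly[OF bs(1)])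
    show "{1..n} \<noteq> {}" by (simp add: n_def)
    fix i assume i: "i \<in> {1..n}"
    show "?B i \<noteq> {}" using N by (auto simp: L_def)
    show "?B i \<subseteq> \<Union>(set bs)" using LX[OF i] bs(2) by auto
    fix S assume S: "S \<subseteq> ?B i" "S \<noteq> {}" "S \<noteq> ?B i"
    \<comment> \<open>In terms of positions, a cut of the layer separates two consecutive integers,
      hence the ends of an edge.\<close>
    let ?T = "{v :: int. to_nat (i, v) \<in> S}"
    have "?B i \<subseteq> range (\<lambda>v :: int. to_nat (i, v))" by (auto simp: L_def)
    then have "S \<subseteq> range (\<lambda>v :: int. to_nat (i, v))" using S(1) by (rule order_trans[rotated])
    then have ST: "S = (\<lambda>v :: int. to_nat (i, v)) ` ?T" by (force simp: subset_iff image_iff)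
    have "?T \<subseteq> {0..<N ^ i}" using S(1) by (auto simp: L_def)
    moreover have "?T \<noteq> {}" using S(2) ST by auto
    moreover have "?T \<noteq> {0..<N ^ i}"
    proof
      assume "?T = {0..<N ^ i}"
      then have "S = ?B i" using ST by (auto simp: L_def)
      then show False using S(3) by blast
    qed
    ultimately obtain v where v: "0 \<le> v" "v + 1 < N ^ i" "(v \<in> ?T) \<noteq> (v + 1 \<in> ?T)"
      using int_interval_cut[of ?T "N ^ i"] by blast
    have vL: "(i, v) \<in> L i" "(i, v + 1) \<in> L i" using v by (auto simp: L_def)
    then have "adj N (i, v) (i, v + 1)" "(i, v) \<in> X" "(i, v + 1) \<in> X"
      using LX[OF i] by (auto simp: adj_def)
    then obtain b where b: "b \<in> set bs" "to_nat (i, v) \<in> b" "to_nat (i, v + 1) \<in> b"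
      using bag by blast
    have vB: "to_nat (i, v) \<in> ?B i" "to_nat (i, v + 1) \<in> ?B i" using vL by blast+
    show "\<exists>b\<in>set bs. b \<inter> S \<noteq> {} \<and> b \<inter> (?B i - S) \<noteq> {}"
    proof (cases "v \<in> ?T")
      case True
      then have "to_nat (i, v) \<in> b \<inter> S" "to_nat (i, v + 1) \<in> b \<inter> (?B i - S)" using v(3) b vB by auto
      then show ?thesis using b(1) by blast
    next
      case False
      then have "to_nat (i, v + 1) \<in> b \<inter> S" "to_nat (i, v) \<in> b \<inter> (?B i - S)" using v(3) b vB by auto
      then show ?thesis using b(1) by blast
    qed
  next
    fix i j assume ij: "i \<in> {1..n}" "j \<in> {1..n}"
    consider "i < j" | "j < i" | "i = j" by linarith
    then show "\<exists>b\<in>set bs. b \<inter> ?B i \<noteq> {} \<and> b \<inter> ?B j \<noteq> {}"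
    proof cases
      case 1 then show ?thesis using touch ij by blast
    next
      case 2 then show ?thesis using touch[OF ij(2,1)] by blast
    next
      case 3
      have "(i, 0) \<in> L i" using N by (auto simp: L_def)
      then have m: "to_nat (i, 0 :: int) \<in> ?B i" "to_nat (i, 0 :: int) \<in> \<Union>(set bs)"
        using LX[OF ij(1)] bs(2) by blast+
      then show ?thesis using 3 by blast
    qed
  qed simp
  then obtain b where b: "b \<in> set bs" "\<forall>i\<in>{1..n}. b \<inter> ?B i \<noteq> {}" by blast
  then have "\<forall>i\<in>{1..n}. \<exists>x. x \<in> L i \<and> to_nat x \<in> b" by blast
  then obtain g where g: "\<And>i. i \<in> {1..n} \<Longrightarrow> g i \<in> L i \<and> to_nat (g i) \<in> b" by metis
  have "fst (g i) = i" if "i \<in> {1..n}" for i using g[OF that] by (auto simp: L_def)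
  then have "inj_on g {1..n}" by (rule inj_on_inverseI)
  then have "inj_on (to_nat \<circ> g) {1..n}"
    by (rule comp_inj_on) (rule inj_on_subset[OF inj_to_nat subset_UNIV])
  moreover have "(to_nat \<circ> g) ` {1..n} \<subseteq> b"
    unfolding image_subset_iff comp_def using g by simp
  moreover have "finite b" using b(1) bs(2) X(1) by (metis Union_upper finite_imageI finite_subset)
  ultimately have "card {1..n} \<le> card b" by (rule card_inj_on_le)
  then show False using bs(3)[OF b(1)] by (simp add: n_def)
qed

end

theorem theorem1p2:
  fixes t :: nat
  assumes "t \<ge> 1"
  shows "\<exists>C. (\<forall>G\<in>C. wf_graph G) \<and> hereditary C \<and> weakly_sparse C \<and>
           \<not> bounded_tw C \<and>
           (\<forall>H. wf_graph H \<and> tw_le H t \<longrightarrow> bounded_tw {G \<in> C. H_free H G})"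
proof -
  \<comment> \<open>A number codes a register, a list of registers and a colour; \<open>mod\<close>
    and the intersection enforce the bounds for arbitrary codes.\<close>
  define code :: "nat \<Rightarrow> nat \<times> nat list \<times> nat" where "code = from_nat"
  define slot where "slot j = fst (code j) mod (t + 1)" for j
  define sel where "sel j = set (fst (snd (code j))) \<inter> {..t}" for j
  interpret register_wheel t slot sel
  proof
    fix j show "slot j \<le> t" "sel j \<subseteq> {..t}" by (auto simp: slot_def sel_def less_Suc_eq_le[symmetric])
  next
    fix s \<alpha> assume s: "s \<le> t" and \<alpha>: "\<alpha> \<subseteq> {..t}"
    obtain xs where xs: "set xs = \<alpha>" using finite_list[OF finite_subset[OF \<alpha>]] by auto
    \<comment> \<open>The colour is arbitrary, which gives infinitely many codes.\<close>
    have "inj (\<lambda>c. to_nat (s, xs, c :: nat))" by (auto simp: inj_def)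
    then have "infinite (range (\<lambda>c. to_nat (s, xs, c :: nat)))" by (simp add: finite_image_iff)
    moreover have "range (\<lambda>c. to_nat (s, xs, c :: nat)) \<subseteq> {j. slot j = s \<and> sel j = \<alpha>}"
      using s \<alpha> xs by (auto simp: slot_def sel_def code_def)
    ultimately show "infinite {j. slot j = s \<and> sel j = \<alpha>}" using infinite_super by blast
  qed
  show ?thesis
    using wf_wheels hereditary_wheels weakly_sparse_wheels unbounded_wheels[OF assms]
      H_free_wheels_bounded by (intro exI[of _ wheels]) blast
qed

end
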